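(* Let $X$ be a ball Banach function space on $\mathbb{R}^n$, $\gamma\in\mathbb{R}\setminus\{0\}$, $p\in[1,\infty)$, and $q\in(0,p]$. Assume that $X^{1/p}$ is a ball Banach function space and that the Hardy--Littlewood maximal operator $\mathcal{M}$ is bounded on both $X$ and $(X^{1/p})'$, with operator norms $\|\mathcal{M}\|_{X\to X}$ and $\|\mathcal{M}\|_{(X^{1/p})'\to(X^{1/p})'}$. Then there exists a positive constant $C$, depending only on $p,q,\gamma,n,\|\mathcal{M}\|_{X\to X}$ and $\|\mathcal{M}\|_{(X^{1/p})'\to(X^{1/p})'}$, such that for every $f\in C^1(\mathbb{R}^n)$ with $|\nabla f|\in C_{\mathrm c}(\mathbb{R}^n)$, $$\sup_{\lambda>0}\lambda\left\|\left[\int_{\mathbb{R}^n}\mathbf{1}_{E_{\lambda,\gamma/q}[f]}(\cdot,y)|\cdot-y|^{\gamma-n}dy\right]^{1/q}\right\|_X\le C\|\,|\nabla f|\,\|_X,$$ and $C$ is continuous with respect to each of $\|\mathcal{M}\|_{X\to X}$ and $\|\mathcal{M}\|_{(X^{1/p})'\to(X^{1/p})'}$ and increases as either of them increases.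
   Context: A quasi-Banach space $X$ of measurable functions on $\mathbb{R}^n$ with quasi-norm defined on all measurable functions is a ball quasi-Banach function space if: $\|f\|_X=0$ implies $f=0$ a.e.; $|g|\le|f|$ a.e. implies $\|g\|_X\le\|f\|_X$; $0\le f_m\uparrow f$ a.e. implies $\|f_m\|_X\uparrow\|f\|_X$; $\mathbf{1}_B\in X$ for every ball $B$. It is a ball Banach function space if moreover the triangle inequality holds and for every ball $B$ there is $C_B$ with $\int_B|f|\le C_B\|f\|_X$ for $f\in X$. For $t>0$, $X^t:=\{f:|f|^t\in X\}$ with $\|f\|_{X^t}:=\|\,|f|^t\|_X^{1/t}$. Associate space of a ball Banach function space $Y$: $Y':=\{f:\|f\|_{Y'}:=\sup_{\|g\|_Y=1}\|fg\|_{L^1}<\infty\}$. $\mathcal{M}f(x):=\sup_{B\ni x}|B|^{-1}\int_B|f|$; bounded on $Y$ means $\|\mathcal{M}f\|_Y\le C\|f\|_Y$, least such $C$ denoted $\|\mathcal{M}\|_{Y\to Y}$. $E_{\lambda,\beta}[f]:=\{(x,y):x\ne y,\ |f(x)-f(y)|/|x-y|^{1+\beta}>\lambda\}$. *)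

theory Defs
  imports "HOL-Analysis.Analysis"
begin

text \<open>A (quasi-)norm is modelled as a functional N on real-valued functions with values
in [0,\<infinity>]; f belongs to the space iff f is Lebesgue measurable and N f < \<infinity>.\<close>

definition ball_BFS :: "(('a::euclidean_space \<Rightarrow> real) \<Rightarrow> ennreal) \<Rightarrow> bool" where
  "ball_BFS N \<longleftrightarrow>
     (\<forall>f\<in>borel_measurable lebesgue. N f = 0 \<longrightarrow> (AE x in lebesgue. f x = 0)) \<and>
     (\<forall>f\<in>borel_measurable lebesgue. \<forall>c::real. N (\<lambda>x. c * f x) = ennreal \<bar>c\<bar> * N f) \<and>
     (\<forall>f\<in>borel_measurable lebesgue. \<forall>g\<in>borel_measurable lebesgue.
        N (\<lambda>x. f x + g x) \<le> N f + N g) \<and>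
     (\<forall>f\<in>borel_measurable lebesgue. \<forall>g\<in>borel_measurable lebesgue.
        (AE x in lebesgue. \<bar>g x\<bar> \<le> \<bar>f x\<bar>) \<longrightarrow> N g \<le> N f) \<and>
     (\<forall>F f. (\<forall>m. F m \<in> borel_measurable lebesgue) \<and> f \<in> borel_measurable lebesgue \<and>
        (AE x in lebesgue. (\<forall>m. 0 \<le> F m x \<and> F m x \<le> F (Suc m) x) \<and> (\<lambda>m. F m x) \<longlonglongrightarrow> f x)
        \<longrightarrow> (\<lambda>m. N (F m)) \<longlonglongrightarrow> N f) \<and>
     (\<forall>c r. N (indicator (ball c r) :: 'a \<Rightarrow> real) < \<infinity>) \<and>
     (\<forall>c r. \<exists>C::real. \<forall>f\<in>borel_measurable lebesgue. N f < \<infinity> \<longrightarrow>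
        (\<integral>\<^sup>+x\<in>ball c r. ennreal \<bar>f x\<bar> \<partial>lebesgue) \<le> ennreal C * N f) \<and>
     (\<forall>F. (\<forall>m. F m \<in> borel_measurable lebesgue \<and> N (F m) < \<infinity>) \<and>
        (\<forall>e>0. \<exists>M. \<forall>m\<ge>M. \<forall>k\<ge>M. N (\<lambda>x. F m x - F k x) < ennreal e) \<longrightarrow>
        (\<exists>f\<in>borel_measurable lebesgue. N f < \<infinity> \<and> (\<lambda>m. N (\<lambda>x. F m x - f x)) \<longlonglongrightarrow> 0))"

definition convexify :: "(('a \<Rightarrow> real) \<Rightarrow> ennreal) \<Rightarrow> real \<Rightarrow> ('a \<Rightarrow> real) \<Rightarrow> ennreal" where
  "convexify N t f = (let v = N (\<lambda>x. \<bar>f x\<bar> powr t) in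
      if v = \<infinity> then \<infinity> else ennreal (enn2real v powr (1 / t)))"

definition assoc :: "(('a::euclidean_space \<Rightarrow> real) \<Rightarrow> ennreal) \<Rightarrow> ('a \<Rightarrow> real) \<Rightarrow> ennreal" where
  "assoc N g = (SUP f\<in>{f\<in>borel_measurable lebesgue. N f = 1}.
       \<integral>\<^sup>+x. ennreal \<bar>f x * g x\<bar> \<partial>lebesgue)"

definition maximal :: "('a::euclidean_space \<Rightarrow> real) \<Rightarrow> 'a \<Rightarrow> ennreal" where
  "maximal f x = (SUP B\<in>{ball c r | c r. 0 < r \<and> x \<in> ball c r}.
       (\<integral>\<^sup>+y\<in>B. ennreal \<bar>f y\<bar> \<partial>lebesgue) / emeasure lebesgue B)"

definition M_bounded_by :: "(('a::euclidean_space \<Rightarrow> real) \<Rightarrow> ennreal) \<Rightarrow> real \<Rightarrow> bool" where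
  "M_bounded_by N C \<longleftrightarrow> 0 \<le> C \<and> (\<forall>f\<in>borel_measurable lebesgue. N f < \<infinity> \<longrightarrow>
      (AE x in lebesgue. maximal f x < \<infinity>) \<and>
      N (\<lambda>x. enn2real (maximal f x)) \<le> ennreal C * N f)"

definition M_bounded :: "(('a::euclidean_space \<Rightarrow> real) \<Rightarrow> ennreal) \<Rightarrow> bool" where
  "M_bounded N \<longleftrightarrow> (\<exists>C. M_bounded_by N C)"

definition Mnorm :: "(('a::euclidean_space \<Rightarrow> real) \<Rightarrow> ennreal) \<Rightarrow> real" where
  "Mnorm N = Inf {C. M_bounded_by N C}"

definition Eset :: "real \<Rightarrow> real \<Rightarrow> ('a::euclidean_space \<Rightarrow> real) \<Rightarrow> ('a \<times> 'a) set" where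
  "Eset lam beta f = {(x, y). x \<noteq> y \<and> \<bar>f x - f y\<bar> / dist x y powr (1 + beta) > lam}"

definition riesz_fun :: "('a::euclidean_space \<times> 'a) set \<Rightarrow> real \<Rightarrow> 'a \<Rightarrow> ennreal" where
  "riesz_fun E gamma x = (\<integral>\<^sup>+y. indicator E (x, y) * ennreal (dist x y powr (gamma - real DIM('a))) \<partial>lebesgue)"

definition Nq :: "(('a::euclidean_space \<Rightarrow> real) \<Rightarrow> ennreal) \<Rightarrow> real \<Rightarrow> ('a \<Rightarrow> ennreal) \<Rightarrow> ennreal" where
  "Nq N q F = (if AE x in lebesgue. F x < \<infinity> then N (\<lambda>x. enn2real (F x) powr (1 / q)) else \<infinity>)"

end

(* Averaging along segments gives |f x - f y| <= C |x - y| (M|grad f| x + M|grad f| y), so that for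
   (x, y) in E one of |x - y|^gamma < b x, |x - y|^gamma < b y holds, where b = (C M|grad f| / lambda)^p.
   For q = p, Fubini and the bound of the truncated Riesz kernel by M show that the integral of
   riesz_fun E against h >= 0 is at most a multiple of the integral of b (h + M h).  By Hoelder for
   Y = X^{1/p} and its associate space this is at most C (1 + B) ||b||_Y ||h||_{Y'}, and the
   Lorentz-Luxemburg theorem Y'' = Y turns it into a bound of the norm in Y.
   The case q < p reduces to q = p with gamma replaced by gamma p / q, which leaves the set E unchanged:
   splitting the integral over |x - y| according to the size of |x - y|^gamma gives a pointwise bound. *)

theory Submission
  imports Defs
begin

subsection \<open>Ball Banach function spaces and duality\<close>

text \<open>The kernel bound does not see the sign of \<open>\<gamma>\<close>: the set
  \<open>|x - y|^\<gamma> < b\<close> is a punctured ball for positive \<open>\<gamma>\<close> and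
  the exterior of a ball for negative \<open>\<gamma>\<close>, and on either one
  \<open>|x - y|^(\<gamma> - n)\<close> has mass of order \<open>b\<close>. The alternative with
  \<open>b x\<close> is therefore settled pointwise, by integrating in \<open>y\<close>. The
  alternative with \<open>b y\<close> gives no pointwise bound at \<open>x\<close>, and this is what
  forces duality: after the integrals are exchanged, the kernel acts on the test function
  \<open>h\<close>, and the boundedness of the maximal operator on the associate space takes over.
  The norm of \<open>b\<close> in Y is the p-th power of the norm of
  \<open>C M|grad f| / lambda\<close> in X, so a final p-th root leaves one factor
  \<open>1 / lambda\<close>, one factor \<open>A\<close> (the operator norm on X) and
  \<open>(1 + B) powr (1 / p)\<close>. Continuity and monotonicity can be read off this product.
  Norms act on real functions, while integrals and maximal functions take values in [0,\<infinity>].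
  As \<open>enn2real\<close> sends \<infinity> to 0, each passage to real values has to come with
  finiteness almost everywhere.\<close>

lemma BFS_definite:
  "ball_BFS N \<Longrightarrow> f \<in> borel_measurable lebesgue \<Longrightarrow> N f = 0 \<Longrightarrow> AE x in lebesgue. f x = 0"
  unfolding ball_BFS_def by blast

lemma BFS_scale:
  "ball_BFS N \<Longrightarrow> f \<in> borel_measurable lebesgue \<Longrightarrow> N (\<lambda>x. c * f x) = ennreal \<bar>c\<bar> * N f"
  unfolding ball_BFS_def by blast

lemma BFS_triangle:
  "ball_BFS N \<Longrightarrow> f \<in> borel_measurable lebesgue \<Longrightarrow> g \<in> borel_measurable lebesgue \<Longrightarrow>
    N (\<lambda>x. f x + g x) \<le> N f + N g"
  unfolding ball_BFS_def by blast

lemma BFS_mono: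
  "ball_BFS N \<Longrightarrow> f \<in> borel_measurable lebesgue \<Longrightarrow> g \<in> borel_measurable lebesgue \<Longrightarrow>
    (AE x in lebesgue. \<bar>g x\<bar> \<le> \<bar>f x\<bar>) \<Longrightarrow> N g \<le> N f"
  unfolding ball_BFS_def by blast

lemma BFS_Fatou:
  assumes "ball_BFS N" "\<And>m. F m \<in> borel_measurable lebesgue" "f \<in> borel_measurable lebesgue"
    "AE x in lebesgue. (\<forall>m. 0 \<le> F m x \<and> F m x \<le> F (Suc m) x) \<and> (\<lambda>m. F m x) \<longlonglongrightarrow> f x"
  shows "(\<lambda>m. N (F m)) \<longlonglongrightarrow> N f"
  using assms unfolding ball_BFS_def by blast

lemma BFS_ball_finite: "ball_BFS N \<Longrightarrow> N (indicator (ball c r)) < \<infinity>"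
  unfolding ball_BFS_def by blast

lemma BFS_local_L1:
  assumes "ball_BFS N"
  obtains C where "\<And>f. f \<in> borel_measurable lebesgue \<Longrightarrow> N f < \<infinity> \<Longrightarrow>
        (\<integral>\<^sup>+x\<in>ball c r. ennreal \<bar>f x\<bar> \<partial>lebesgue) \<le> ennreal C * N f"
proof -
  have "\<forall>c r. \<exists>C::real. \<forall>f\<in>borel_measurable lebesgue. N f < \<infinity> \<longrightarrow>
        (\<integral>\<^sup>+x\<in>ball c r. ennreal \<bar>f x\<bar> \<partial>lebesgue) \<le> ennreal C * N f"
    using assms unfolding ball_BFS_def by (elim conjE) assumption
  then show ?thesis using that by blast
qed

lemma BFS_zero: "ball_BFS N \<Longrightarrow> N (\<lambda>x. 0) = 0"
  using BFS_scale[of N "\<lambda>x. 0" 0] by simp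

text \<open>The Fatou property is an axiom for increasing sequences only. The tail infima
  \<open>G n\<close> increase to the same limit and lie below \<open>g n\<close>, so they inherit
  the bound.\<close>

lemma BFS_liminf_le:
  assumes N: "ball_BFS N" and m: "\<And>n. g n \<in> borel_measurable lebesgue" "u \<in> borel_measurable lebesgue"
    and nonneg: "\<And>n x. 0 \<le> g n x" and bound: "\<And>n. N (g n) \<le> C"
    and lim: "AE x in lebesgue. (\<lambda>n. g n x) \<longlonglongrightarrow> u x"
  shows "N u \<le> C"
proof -
  define G where "G n x = (INF k\<in>{n..}. g k x)" for n x
  have bdd: "bdd_below ((\<lambda>k. g k x) ` A)" for x A
    using nonneg by (meson bdd_belowI2)
  have Gm: "G n \<in> borel_measurable lebesgue" for n
    unfolding G_def by (rule borel_measurable_cINF) (use m bdd in auto)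
  have G0: "0 \<le> G n x" for n x
    unfolding G_def by (rule cINF_greatest) (use nonneg in auto)
  have Gle: "G n x \<le> g n x" for n x
    unfolding G_def by (rule cINF_lower) (use bdd in auto)
  have Gmono: "G n x \<le> G (Suc n) x" for n x
    unfolding G_def by (rule cINF_superset_mono) (use bdd in auto)
  have "(\<lambda>n. N (G n)) \<longlonglongrightarrow> N u"
  proof (rule BFS_Fatou[OF N Gm m(2)])
    show "AE x in lebesgue. (\<forall>n. 0 \<le> G n x \<and> G n x \<le> G (Suc n) x) \<and> (\<lambda>n. G n x) \<longlonglongrightarrow> u x"
      using lim
    proof eventually_elim
      case (elim x)
      have "(\<lambda>n. G n x) \<longlonglongrightarrow> u x"
      proof (rule LIMSEQ_I)
        fix r :: real assume "0 < r"
        then obtain n0 where n0: "\<And>n. n \<ge> n0 \<Longrightarrow> \<bar>g n x - u x\<bar> < r / 2"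
          using LIMSEQ_D[OF elim, of "r/2"] by auto
        have "norm (G n x - u x) < r" if "n \<ge> n0" for n
        proof -
          have "u x - r / 2 \<le> G n x"
            unfolding G_def by (rule cINF_greatest) (use n0 that in \<open>auto simp: abs_if split: if_splits, smt (verit) field_sum_of_halves le_trans\<close>)
          moreover have "G n x \<le> u x + r / 2" using Gle[of n x] n0[OF that] by linarith
          ultimately show ?thesis using \<open>0 < r\<close> by (simp add: abs_if)
        qed
        then show "\<exists>no. \<forall>n\<ge>no. norm (G n x - u x) < r" by blast
      qed
      then show ?case using G0 Gmono by blast
    qed
  qed
  moreover have "N (G n) \<le> C" for n
  proof -
    have "N (G n) \<le> N (g n)"
      by (rule BFS_mono[OF N m(1) Gm]) (use G0 Gle nonneg in auto)
    then show ?thesis using bound order_trans by blast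
  qed
  ultimately show ?thesis using LIMSEQ_le_const2 by blast
qed

lemma integrable_bounded_ball:
  fixes u :: "'a::euclidean_space \<Rightarrow> real"
  assumes "u \<in> borel_measurable lebesgue" and b: "\<And>x. \<bar>u x\<bar> \<le> K" and s: "\<And>x. x \<notin> ball 0 R \<Longrightarrow> u x = 0"
  shows "integrable lebesgue u"
proof (rule Bochner_Integration.integrable_bound)
  show "integrable lebesgue (\<lambda>x. K * indicator (ball 0 R) x :: real)"
    by (intro integrable_mult_right integrable_real_indicator) (use emeasure_lborel_ball_finite[of 0 R] in auto)
  show "AE x in lebesgue. norm (u x) \<le> norm (K * indicator (ball 0 R) x :: real)"
  proof (rule AE_I2)
    fix x show "norm (u x) \<le> norm (K * indicator (ball 0 R) x :: real)"
      using b[of x] s[of x] by (cases "x \<in> ball 0 R") auto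
  qed
qed (use assms in auto)

text \<open>The supremum in \<open>assoc\<close> runs over functions of norm exactly 1, so
  \<open>f\<close> is divided by its norm. If that norm is 0, definiteness makes the integral
  vanish, which also fits the convention \<open>0 * \<infinity> = 0\<close> on the right.\<close>

lemma assoc_Hoelder:
  fixes f g :: "'a::euclidean_space \<Rightarrow> real"
  assumes N: "ball_BFS N" and f: "f \<in> borel_measurable lebesgue" and g: "g \<in> borel_measurable lebesgue" and fin: "N f < \<infinity>"
  shows "(\<integral>\<^sup>+x. ennreal \<bar>f x * g x\<bar> \<partial>lebesgue) \<le> N f * assoc N g"
proof (cases "N f = 0")
  case True
  then have "AE x in lebesgue. f x = 0" by (rule BFS_definite[OF N f])
  then have "(\<integral>\<^sup>+x. ennreal \<bar>f x * g x\<bar> \<partial>lebesgue) = (\<integral>\<^sup>+x. 0 \<partial>(lebesgue :: 'a measure))"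
    by (intro nn_integral_cong_AE) auto
  then show ?thesis by simp
next
  case False
  then obtain c where c: "N f = ennreal c" "c > 0"
    using fin by (cases "N f") (auto simp: ennreal_eq_0_iff)
  define u where "u x = (1 / c) * f x" for x
  have "N u = 1" unfolding u_def
    using BFS_scale[OF N f, of "1/c"] c by (simp add: ennreal_mult[symmetric])
  moreover have "u \<in> borel_measurable lebesgue" unfolding u_def using f by simp
  ultimately have "(\<integral>\<^sup>+x. ennreal \<bar>u x * g x\<bar> \<partial>lebesgue) \<le> assoc N g"
    unfolding assoc_def by (intro SUP_upper) auto
  then have "ennreal c * (\<integral>\<^sup>+x. ennreal \<bar>u x * g x\<bar> \<partial>lebesgue) \<le> N f * assoc N g"
    using c by (auto intro: mult_left_mono)
  also have "ennreal c * (\<integral>\<^sup>+x. ennreal \<bar>u x * g x\<bar> \<partial>lebesgue) = (\<integral>\<^sup>+x. ennreal c * ennreal \<bar>u x * g x\<bar> \<partial>lebesgue)"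
    using f g by (intro nn_integral_cmult[symmetric]) (auto simp: u_def)
  also have "\<dots> = (\<integral>\<^sup>+x. ennreal \<bar>f x * g x\<bar> \<partial>lebesgue)"
    using c by (intro nn_integral_cong) (auto simp: u_def ennreal_mult[symmetric] abs_mult)
  finally show ?thesis .
qed

section \<open>Separating a function from the unit ball by projection in L2\<close>

lemma BFS_convex:
  assumes N: "ball_BFS N" and m: "g \<in> borel_measurable lebesgue" "h \<in> borel_measurable lebesgue"
    and le: "N g \<le> 1" "N h \<le> 1" and t: "0 \<le> t" "t \<le> 1"
  shows "N (\<lambda>x. (1 - t) * g x + t * h x) \<le> 1"
proof -
  have "N (\<lambda>x. (1 - t) * g x + t * h x) \<le> N (\<lambda>x. (1 - t) * g x) + N (\<lambda>x. t * h x)"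
    using m by (intro BFS_triangle[OF N]) auto
  also have "\<dots> = ennreal (1 - t) * N g + ennreal t * N h"
    using BFS_scale[OF N m(1), of "1 - t"] BFS_scale[OF N m(2), of t] t by simp
  also have "\<dots> \<le> ennreal (1 - t) * 1 + ennreal t * 1"
    using le by (intro add_mono mult_left_mono) auto
  also have "\<dots> = 1" using t by (simp add: ennreal_plus[symmetric])
  finally show ?thesis .
qed

text \<open>The functional h is a multiple of f - g0, where g0 is the projection of f in L2 onto the convex set
of all g with 0 \<le> g \<le> f and N g \<le> 1; working in L2 avoids the Hahn-Banach theorem and the dual of L1.\<close>
lemma BFS_separation:
  fixes f :: "'a::euclidean_space \<Rightarrow> real"
  assumes N: "ball_BFS N" and fm: "f \<in> borel_measurable lebesgue"
    and f0: "\<And>x. 0 \<le> f x" and fK: "\<And>x. f x \<le> K" and supp: "\<And>x. x \<notin> ball 0 R \<Longrightarrow> f x = 0"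
    and big: "1 < N f"
  obtains h where "h \<in> borel_measurable lebesgue" "\<And>x. 0 \<le> h x" "assoc N h \<le> 1"
    "1 < (\<integral>\<^sup>+x. ennreal (f x * h x) \<partial>lebesgue)"
proof -
  note [measurable] = fm
  have K0: "0 \<le> K" using f0 fK order_trans by blast
  \<comment> \<open>The constraint \<open>g \<le> f\<close> keeps all competitors bounded by
    \<open>K\<close> and supported in one ball, so that their squares are integrable and share a
    dominating function. The price is paid in \<open>var\<close>, where test functions need not lie
    below \<open>f\<close>.\<close>
  define S where "S = {g \<in> borel_measurable lebesgue. (\<forall>x. 0 \<le> g x \<and> g x \<le> f x) \<and> N g \<le> 1}"
  define J where "J g = (\<integral>x. (f x - g x)\<^sup>2 \<partial>lebesgue)" for g
  define d where "d = (INF g\<in>S. J g)"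
  have Sm: "g \<in> S \<Longrightarrow> g \<in> borel_measurable lebesgue" for g by (auto simp: S_def)
  have S0: "g \<in> S \<Longrightarrow> 0 \<le> g x" and Sf: "g \<in> S \<Longrightarrow> g x \<le> f x" and SN: "g \<in> S \<Longrightarrow> N g \<le> 1" for g x
    by (auto simp: S_def)
  have SK: "g \<in> S \<Longrightarrow> g x \<le> K" for g x using Sf fK order_trans by blast
  have Ssupp: "g \<in> S \<Longrightarrow> x \<notin> ball 0 R \<Longrightarrow> g x = 0" for g x
    using S0[of g x] Sf[of g x] supp[of x] by simp
  have zS: "(\<lambda>x. 0) \<in> S" using f0 BFS_zero[OF N] by (auto simp: S_def)
  have J0: "0 \<le> J g" for g unfolding J_def by simp
  have bddJ: "bdd_below (J ` S)" using J0 by (meson bdd_belowI2)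
  have dJ: "g \<in> S \<Longrightarrow> d \<le> J g" for g unfolding d_def using bddJ by (rule cINF_lower)
  have sq_int: "integrable lebesgue (\<lambda>x. (u x)\<^sup>2)" if "u \<in> borel_measurable lebesgue"
    "\<And>x. \<bar>u x\<bar> \<le> L" "\<And>x. x \<notin> ball 0 R \<Longrightarrow> u x = 0" for u :: "'a \<Rightarrow> real" and L
  proof (rule integrable_bounded_ball[where K="L\<^sup>2" and R=R])
    show "\<bar>(u x)\<^sup>2\<bar> \<le> L\<^sup>2" for x
      using power_mono[OF that(2)[of x], of 2] by simp
  qed (use that in auto)
  have diffK: "\<bar>f x - g x\<bar> \<le> K" if "g \<in> S" for g x
    using f0[of x] fK[of x] S0[OF that, of x] SK[OF that, of x] by linarith
  have Jint: "integrable lebesgue (\<lambda>x. (f x - g x)\<^sup>2)" if "g \<in> S" for g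
    by (rule sq_int[where L=K]) (use that diffK Ssupp supp Sm[OF that] in auto)
  \<comment> \<open>The rate \<open>(1/4)^n\<close> makes the L2 distances of consecutive terms of
    order \<open>(1/2)^n\<close>, hence summable. The minimizing sequence itself then converges
    almost everywhere, without passing to a subsequence.\<close>
  have "\<exists>g\<in>S. J g < d + (1/4)^n" for n :: nat
  proof (rule ccontr)
    assume "\<not> (\<exists>g\<in>S. J g < d + (1/4)^n)"
    then have "d + (1/4)^n \<le> (INF g\<in>S. J g)"
      by (intro cINF_greatest) (use zS in \<open>auto simp: not_less\<close>)
    then have "d + (1/4)^n \<le> d" by (simp only: d_def)
    then show False using zero_less_power[of "1/4::real" n] by linarith
  qed
  then obtain g where gS: "\<And>n. g n \<in> S" and gJ: "\<And>n. J (g n) < d + (1/4)^n" by metis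
  note gm[measurable] = Sm[OF gS]
  have dist_int: "integrable lebesgue (\<lambda>x. (g n x - g (Suc n) x)\<^sup>2)" for n
  proof (rule sq_int[where L=K])
    show "\<bar>g n x - g (Suc n) x\<bar> \<le> K" for x
      using S0[OF gS, of n x] SK[OF gS, of n x] S0[OF gS, of "Suc n" x] SK[OF gS, of "Suc n" x] by linarith
  qed (use Ssupp[OF gS] in auto)
  \<comment> \<open>Parallelogram law: the midpoint \<open>m\<close> stays in \<open>S\<close> by
    convexity, so \<open>J m\<close> cannot fall below \<open>d\<close>.\<close>
  have dist_le: "(\<integral>x. (g n x - g (Suc n) x)\<^sup>2 \<partial>lebesgue) \<le> 4 * (1/4)^n" for n
  proof -
    define m where "m x = (1 - 1/2) * g n x + 1/2 * g (Suc n) x" for x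
    have mS: "m \<in> S"
    proof -
      have "N m \<le> 1" unfolding m_def by (rule BFS_convex[OF N]) (use SN[OF gS] in auto)
      moreover have "0 \<le> m x \<and> m x \<le> f x" for x
        using S0[OF gS, of n x] Sf[OF gS, of n x] S0[OF gS, of "Suc n" x] Sf[OF gS, of "Suc n" x]
        by (simp add: m_def)
      ultimately show ?thesis by (auto simp: S_def m_def[abs_def])
    qed
    have "(\<integral>x. (g n x - g (Suc n) x)\<^sup>2 \<partial>lebesgue) =
      (\<integral>x. (2 * (f x - g n x)\<^sup>2 + 2 * (f x - g (Suc n) x)\<^sup>2) - 4 * (f x - m x)\<^sup>2 \<partial>lebesgue)"
      by (rule Bochner_Integration.integral_cong) (auto simp: m_def power2_eq_square algebra_simps)
    also have "\<dots> = 2 * J (g n) + 2 * J (g (Suc n)) - 4 * J m"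
      unfolding J_def using Jint[OF gS] Jint[OF mS]
      by simp
    also have "\<dots> \<le> 2 * (d + (1/4)^n) + 2 * (d + (1/4)^Suc n) - 4 * d"
      using gJ[of n] gJ[of "Suc n"] dJ[OF mS] by (intro diff_mono add_mono mult_left_mono) auto
    also have "\<dots> \<le> 4 * (1/4)^n" by simp
    finally show ?thesis .
  qed
  define V where "V = measure lebesgue (ball (0::'a) R)"
  \<comment> \<open>From L2 to L1 on a ball by \<open>u \<le> 2^n * u^2 + (1/2)^n\<close>. The
    weight \<open>2^n\<close> is balanced so that both terms are of order \<open>(1/2)^n\<close>
    after integration.\<close>
  have L1: "(\<integral>\<^sup>+x. ennreal \<bar>g n x - g (Suc n) x\<bar> \<partial>lebesgue) \<le> ennreal ((4 + V) * (1/2)^n)" for n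
  proof -
    have ib: "integrable lebesgue (\<lambda>x. (1/2)^n * indicator (ball (0::'a) R) x :: real)"
    proof (rule integrable_bounded_ball[where K="1" and R=R])
      show "\<bar>(1/2)^n * indicator (ball (0::'a) R) x :: real\<bar> \<le> 1" for x
        by (simp add: indicator_def power_le_one)
      show "(\<lambda>x. (1/2)^n * indicator (ball (0::'a) R) x :: real) \<in> borel_measurable lebesgue"
        by (intro borel_measurable_times borel_measurable_indicator borel_measurable_const) auto
    qed auto
    have "(\<integral>\<^sup>+x. ennreal \<bar>g n x - g (Suc n) x\<bar> \<partial>lebesgue)
      \<le> (\<integral>\<^sup>+x. ennreal (2^n * (g n x - g (Suc n) x)\<^sup>2 + (1/2)^n * indicator (ball (0::'a) R) x) \<partial>lebesgue)"
    proof (intro nn_integral_mono ennreal_leI)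
      fix x :: 'a
      show "\<bar>g n x - g (Suc n) x\<bar> \<le> 2^n * (g n x - g (Suc n) x)\<^sup>2 + (1/2)^n * indicator (ball (0::'a) R) x"
      proof (cases "x \<in> ball 0 R")
        case True
        define u where "u = \<bar>g n x - g (Suc n) x\<bar>"
        have "u \<le> 2^n * u\<^sup>2 + (1/2)^n"
        proof (cases "u \<le> (1/2)^n")
          case False
          then have "1 \<le> 2^n * u" by (simp add: field_simps)
          then have "u * 1 \<le> u * (2^n * u)" by (intro mult_left_mono) (auto simp: u_def)
          then have "u \<le> 2^n * u\<^sup>2" by (simp add: power2_eq_square algebra_simps)
          then show ?thesis by (intro add_increasing2) auto
        qed (simp add: add_increasing)
        then show ?thesis using True by (simp add: u_def)
      next
        case False
        then show ?thesis using Ssupp[OF gS] by auto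
      qed
    qed
    also have "\<dots> = ennreal (\<integral>x. (2^n * (g n x - g (Suc n) x)\<^sup>2 + (1/2)^n * indicator (ball (0::'a) R) x) \<partial>lebesgue)"
      by (rule nn_integral_eq_integral) (use dist_int[of n] ib in auto)
    also have "(\<integral>x. (2^n * (g n x - g (Suc n) x)\<^sup>2 + (1/2)^n * indicator (ball (0::'a) R) x) \<partial>lebesgue)
       = 2^n * (\<integral>x. (g n x - g (Suc n) x)\<^sup>2 \<partial>lebesgue) + (1/2)^n * V"
      using dist_int[of n] ib by (simp add: V_def)
    also have "\<dots> \<le> 2^n * (4 * (1/4)^n) + (1/2)^n * V"
      using dist_le[of n] by (intro add_mono mult_left_mono) auto
    also have "\<dots> = 4 * (2^n * (1/4)^n) + V * (1/2)^n" by simp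
    also have "2^n * (1/4)^n = ((1/2)^n :: real)" unfolding power_mult_distrib[symmetric] by simp
    also have "4 * (1/2)^n + V * (1/2)^n = (4 + V) * (1/2)^n" by (rule distrib_right[symmetric])
    finally show ?thesis by (simp add: ennreal_leI)
  qed
  have V0: "0 \<le> V" by (simp add: V_def)
  have "(\<integral>\<^sup>+x. (\<Sum>n. ennreal \<bar>g n x - g (Suc n) x\<bar>) \<partial>lebesgue) = (\<Sum>n. \<integral>\<^sup>+x. ennreal \<bar>g n x - g (Suc n) x\<bar> \<partial>lebesgue)"
    by (rule nn_integral_suminf) auto
  also have "\<dots> \<le> (\<Sum>n. ennreal ((4 + V) * (1/2)^n))"
    by (intro suminf_le L1) auto
  also have "\<dots> = ennreal (\<Sum>n. (4 + V) * (1/2)^n)"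
    by (rule suminf_ennreal2) (use V0 in \<open>auto intro!: summable_mult summable_geometric\<close>)
  finally have "(\<integral>\<^sup>+x. (\<Sum>n. ennreal \<bar>g n x - g (Suc n) x\<bar>) \<partial>lebesgue) \<noteq> \<infinity>"
    by (auto simp: top_unique)
  then have "AE x in lebesgue. (\<Sum>n. ennreal \<bar>g n x - g (Suc n) x\<bar>) \<noteq> \<infinity>"
    by (intro nn_integral_PInf_AE) auto
  then have conv: "AE x in lebesgue. convergent (\<lambda>n. g n x)"
  proof eventually_elim
    case (elim x)
    then have "summable (\<lambda>n. \<bar>g n x - g (Suc n) x\<bar>)"
      by (intro summable_suminf_not_top) auto
    then have "summable (\<lambda>n. g n x - g (Suc n) x)"
      by (rule summable_rabs_cancel)
    then have "convergent (\<lambda>n. \<Sum>k<n. g k x - g (Suc k) x)"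
      by (simp add: summable_iff_convergent)
    then have "convergent (\<lambda>n. g 0 x - g n x)"
      unfolding sum_lessThan_telescope'[of "\<lambda>n. g n x"] .
    then obtain l where "(\<lambda>n. g 0 x - g n x) \<longlonglongrightarrow> l" by (auto simp: convergent_def)
    then have "(\<lambda>n. g 0 x - (g 0 x - g n x)) \<longlonglongrightarrow> g 0 x - l" by (intro tendsto_intros)
    then show ?case by (auto simp: convergent_def)
  qed
  \<comment> \<open>Clipping to \<open>[0, f x]\<close> changes nothing where the sequence
    converges, and makes the pointwise constraints of \<open>S\<close> hold also on the null set
    where it does not.\<close>
  define g0 where "g0 x = max 0 (min (f x) (lim (\<lambda>n. g n x)))" for x
  have g0m[measurable]: "g0 \<in> borel_measurable lebesgue" unfolding g0_def by measurable
  have lim: "AE x in lebesgue. (\<lambda>n. g n x) \<longlonglongrightarrow> g0 x"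
    using conv
  proof eventually_elim
    case (elim x)
    then have l: "(\<lambda>n. g n x) \<longlonglongrightarrow> lim (\<lambda>n. g n x)" by (simp add: convergent_LIMSEQ_iff)
    have "0 \<le> lim (\<lambda>n. g n x)" by (rule LIMSEQ_le_const[OF l]) (use S0[OF gS] in auto)
    moreover have "lim (\<lambda>n. g n x) \<le> f x" by (rule LIMSEQ_le_const2[OF l]) (use Sf[OF gS] in auto)
    ultimately show ?case using l by (simp add: g0_def)
  qed
  have g0S: "g0 \<in> S"
  proof -
    have "N g0 \<le> 1"
      by (rule BFS_liminf_le[OF N gm g0m _ _ lim]) (use S0[OF gS] SN[OF gS] in auto)
    then show ?thesis using f0 by (auto simp: S_def g0_def[abs_def])
  qed
  have "(\<lambda>n. J (g n)) \<longlonglongrightarrow> J g0"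
    unfolding J_def
  proof (rule integral_dominated_convergence)
    show "integrable lebesgue (\<lambda>x. (K * indicator (ball (0::'a) R) x)\<^sup>2 :: real)"
    proof (rule sq_int[where L=K])
      show "(\<lambda>x. K * indicator (ball (0::'a) R) x :: real) \<in> borel_measurable lebesgue"
        by (intro borel_measurable_times borel_measurable_indicator borel_measurable_const) auto
    qed (use K0 in \<open>auto simp: indicator_def\<close>)
    show "AE x in lebesgue. (\<lambda>n. (f x - g n x)\<^sup>2) \<longlonglongrightarrow> (f x - g0 x)\<^sup>2"
      using lim by eventually_elim (intro tendsto_intros)
    show "AE x in lebesgue. norm ((f x - g n x)\<^sup>2) \<le> (K * indicator (ball (0::'a) R) x)\<^sup>2" for n
    proof (rule AE_I2)
      fix x show "norm ((f x - g n x)\<^sup>2) \<le> (K * indicator (ball (0::'a) R) x)\<^sup>2"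
        using power_mono[OF diffK[OF gS, of x n], of 2] Ssupp[OF gS, of x n] supp[of x]
        by (cases "x \<in> ball 0 R") auto
    qed
  qed auto
  moreover have "(\<lambda>n. J (g n)) \<longlonglongrightarrow> d"
  proof (rule tendsto_sandwich[of "\<lambda>n. d" _ _ "\<lambda>n. d + (1/4)^n"])
    have "(\<lambda>n. d + (1/4)^n) \<longlonglongrightarrow> d + 0" by (intro tendsto_intros LIMSEQ_power_zero) auto
    then show "(\<lambda>n. d + (1/4)^n) \<longlonglongrightarrow> d" by simp
  qed (use dJ[OF gS] gJ in \<open>auto intro!: always_eventually less_imp_le\<close>)
  ultimately have Jd: "J g0 = d" using LIMSEQ_unique by blast

  define \<phi> where "\<phi> x = f x - g0 x" for x
  have \<phi>m[measurable]: "\<phi> \<in> borel_measurable lebesgue" unfolding \<phi>_def by measurable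
  have \<phi>0: "0 \<le> \<phi> x" and \<phi>K: "\<phi> x \<le> K" for x
    using Sf[OF g0S, of x] S0[OF g0S, of x] fK[of x] by (auto simp: \<phi>_def)
  have \<phi>s: "x \<notin> ball 0 R \<Longrightarrow> \<phi> x = 0" for x
    using Ssupp[OF g0S, of x] supp[of x] by (simp add: \<phi>_def)
  have prod_int: "integrable lebesgue (\<lambda>x. \<phi> x * w x)" if "w \<in> borel_measurable lebesgue" "\<And>x. \<bar>w x\<bar> \<le> L" for w L
  proof (rule integrable_bounded_ball[where K="K * L" and R=R])
    show "\<bar>\<phi> x * w x\<bar> \<le> K * L" for x
      unfolding abs_mult using \<phi>0[of x] \<phi>K[of x] that(2)[of x] K0 by (intro mult_mono) auto
  qed (use that \<phi>s in auto)
  define c where "c = (\<integral>x. \<phi> x * g0 x \<partial>lebesgue)"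
  have g0i: "integrable lebesgue (\<lambda>x. \<phi> x * g0 x)"
    by (rule prod_int[where L=K]) (use S0[OF g0S] SK[OF g0S] in auto)
  have c0: "0 \<le> c" unfolding c_def using \<phi>0 S0[OF g0S] by (intro integral_nonneg_AE) auto
  \<comment> \<open>Variational inequality at the projection. The competitor
    \<open>u = (1 - t) * g0 + t * w\<close> may exceed \<open>f\<close>, so it is cut to
    \<open>v = min f u\<close>, which lies in \<open>S\<close>. The cut only shortens the distance
    to \<open>f\<close>, so minimality of \<open>g0\<close> still yields an inequality for
    \<open>u\<close>. Expanding the square and dividing by \<open>t\<close> gives
    \<open>key\<close>.\<close>
  have var: "(\<integral>x. \<phi> x * w x \<partial>lebesgue) \<le> c"
    if wm[measurable]: "w \<in> borel_measurable lebesgue" and w0: "\<And>x. 0 \<le> w x" and wL: "\<And>x. w x \<le> L"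
      and ws: "\<And>x. x \<notin> ball 0 R \<Longrightarrow> w x = 0" and wN: "N w \<le> 1" for w L
  proof -
    define a where "a = (\<integral>x. \<phi> x * w x \<partial>lebesgue) - c"
    define D where "D = (\<integral>x. (w x - g0 x)\<^sup>2 \<partial>lebesgue)"
    have wi: "integrable lebesgue (\<lambda>x. \<phi> x * w x)"
      by (rule prod_int[where L=L]) (use w0 wL in auto)
    have Di: "integrable lebesgue (\<lambda>x. (w x - g0 x)\<^sup>2)"
    proof (rule sq_int[where L="L + K"])
      show "\<bar>w x - g0 x\<bar> \<le> L + K" for x
        using w0[of x] wL[of x] S0[OF g0S, of x] SK[OF g0S, of x] by linarith
    qed (use ws Ssupp[OF g0S] in auto)
    have \<phi>i: "integrable lebesgue (\<lambda>x. (\<phi> x)\<^sup>2)" using Jint[OF g0S] by (simp add: \<phi>_def)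
    have D0: "0 \<le> D" by (simp add: D_def)
    have key: "2 * a \<le> t * D" if t: "0 < t" "t \<le> 1" for t
    proof -
      define u where "u x = (1 - t) * g0 x + t * w x" for x
      have um[measurable]: "u \<in> borel_measurable lebesgue" unfolding u_def by measurable
      have u0: "0 \<le> u x" for x using t w0 S0[OF g0S] by (auto simp: u_def)
      define v where "v x = min (f x) (u x)" for x
      have vm[measurable]: "v \<in> borel_measurable lebesgue" unfolding v_def by measurable
      have "N u \<le> 1" unfolding u_def
        by (rule BFS_convex[OF N]) (use SN[OF g0S] wN t in auto)
      moreover have "N v \<le> N u"
        by (rule BFS_mono[OF N]) (use u0 f0 in \<open>auto simp: v_def\<close>)
      ultimately have vS: "v \<in> S" using f0 u0 vm by (auto simp: S_def v_def[abs_def])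
      have ui: "integrable lebesgue (\<lambda>x. (f x - u x)\<^sup>2)"
      proof (rule sq_int[where L="K + (K + L)"])
        fix x
        have "u x \<le> 1 * K + 1 * L" unfolding u_def
          using t w0[of x] wL[of x] S0[OF g0S, of x] SK[OF g0S, of x] by (intro add_mono mult_mono) auto
        then show "\<bar>f x - u x\<bar> \<le> K + (K + L)"
          using u0[of x] f0[of x] fK[of x] w0[of x] wL[of x] K0 by linarith
      qed (use ws Ssupp[OF g0S] supp in \<open>auto simp: u_def\<close>)
      have "d \<le> J v" by (rule dJ[OF vS])
      also have "\<dots> \<le> (\<integral>x. (f x - u x)\<^sup>2 \<partial>lebesgue)"
        unfolding J_def
      proof (rule integral_mono[OF Jint[OF vS] ui])
        show "(f x - v x)\<^sup>2 \<le> (f x - u x)\<^sup>2" for x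
          by (simp add: v_def min_def)
      qed
      also have "\<dots> = (\<integral>x. ((\<phi> x)\<^sup>2 + t\<^sup>2 * (w x - g0 x)\<^sup>2) - (2 * t) * (\<phi> x * w x - \<phi> x * g0 x) \<partial>lebesgue)"
        by (rule Bochner_Integration.integral_cong) (auto simp: u_def \<phi>_def power2_eq_square algebra_simps)
      also have "\<dots> = d + t\<^sup>2 * D - 2 * t * a"
        using Di \<phi>i wi g0i unfolding Jd[symmetric] J_def D_def a_def c_def by (simp add: \<phi>_def[symmetric])
      finally have "t * (2 * a) \<le> t * (t * D)" by (simp add: power2_eq_square algebra_simps)
      then show ?thesis using t by simp
    qed
    have "a \<le> 0"
    proof (rule ccontr)
      assume "\<not> a \<le> 0"
      then have a: "0 < a" by simp
      \<comment> \<open>This makes \<open>t * D \<le> a\<close>, against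
        \<open>2 * a \<le> t * D\<close>. The summand 1 keeps the denominator positive when
        \<open>D = 0\<close>.\<close>
      define t where "t = min 1 (a / (D + 1))"
      have "0 < t" "t \<le> 1" "t \<le> a / (D + 1)" using a D0 by (auto simp: t_def)
      then have "2 * a \<le> a / (D + 1) * D" using key[of t] D0
        by (meson mult_right_mono order_trans)
      also have "\<dots> \<le> a" using a D0 by (simp add: field_simps)
      finally show False using a by simp
    qed
    then show ?thesis by (simp add: a_def)
  qed
  \<comment> \<open>Boundedness, support and sign of \<open>w\<close> are removed by monotone
    convergence along the truncations \<open>W k\<close>; cutting to the ball loses nothing because
    \<open>\<phi>\<close> vanishes outside it.\<close>
  have varN: "(\<integral>\<^sup>+x. ennreal \<bar>w x * \<phi> x\<bar> \<partial>lebesgue) \<le> ennreal c"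
    if wm[measurable]: "w \<in> borel_measurable lebesgue" and wN: "N w \<le> 1" for w
  proof -
    define W where "W k x = min \<bar>w x\<bar> (real k) * indicator (ball 0 R) x" for k x
    have Wm[measurable]: "W k \<in> borel_measurable lebesgue" for k
      unfolding W_def by (intro borel_measurable_times borel_measurable_indicator) (measurable, auto)
    have le: "(\<integral>\<^sup>+x. ennreal (\<phi> x * W k x) \<partial>lebesgue) \<le> ennreal c" for k
    proof -
      have "N (W k) \<le> N w" by (rule BFS_mono[OF N]) (auto simp: W_def indicator_def)
      then have "N (W k) \<le> 1" using wN by (rule order_trans)
      then have "(\<integral>x. \<phi> x * W k x \<partial>lebesgue) \<le> c"
        by (rule var[OF Wm, where L="real k", rotated 3]) (auto simp: W_def indicator_def)
      moreover have "(\<integral>\<^sup>+x. ennreal (\<phi> x * W k x) \<partial>lebesgue) = ennreal (\<integral>x. \<phi> x * W k x \<partial>lebesgue)"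
        by (rule nn_integral_eq_integral[OF prod_int[OF Wm, where L="real k"]])
           (use \<phi>0 in \<open>auto simp: W_def indicator_def\<close>)
      ultimately show ?thesis by (simp add: ennreal_leI)
    qed
    have "(\<integral>\<^sup>+x. ennreal \<bar>w x * \<phi> x\<bar> \<partial>lebesgue) \<le> (\<integral>\<^sup>+x. (SUP k. ennreal (\<phi> x * W k x)) \<partial>lebesgue)"
    proof (rule nn_integral_mono)
      fix x
      obtain k :: nat where "\<bar>w x\<bar> \<le> real k" using real_arch_simple by blast
      then have "\<bar>w x * \<phi> x\<bar> \<le> \<phi> x * W k x"
        using \<phi>0[of x] \<phi>s[of x] by (cases "x \<in> ball 0 R") (auto simp: W_def abs_mult)
      then show "ennreal \<bar>w x * \<phi> x\<bar> \<le> (SUP k. ennreal (\<phi> x * W k x))"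
        by (intro SUP_upper2[of k]) (auto intro: ennreal_leI)
    qed
    also have "\<dots> = (SUP k. (\<integral>\<^sup>+x. ennreal (\<phi> x * W k x) \<partial>lebesgue))"
    proof (rule nn_integral_monotone_convergence_SUP)
      show "incseq (\<lambda>k x. ennreal (\<phi> x * W k x))"
        using \<phi>0 by (auto simp: incseq_def le_fun_def W_def indicator_def intro!: ennreal_leI mult_left_mono)
    qed measurable
    also have "\<dots> \<le> ennreal c" using le by (rule SUP_least)
    finally show ?thesis .
  qed
  define e where "e = (\<integral>x. (\<phi> x)\<^sup>2 \<partial>lebesgue)"
  have \<phi>i: "integrable lebesgue (\<lambda>x. (\<phi> x)\<^sup>2)" using Jint[OF g0S] by (simp add: \<phi>_def)
  have "e \<noteq> 0"
  proof
    assume "e = 0"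
    then have "AE x in lebesgue. (\<phi> x)\<^sup>2 = 0"
      using integral_nonneg_eq_0_iff_AE[OF \<phi>i] by (simp add: e_def)
    then have "AE x in lebesgue. \<bar>f x\<bar> \<le> \<bar>g0 x\<bar>"
      by eventually_elim (auto simp: \<phi>_def)
    then have "N f \<le> N g0" by (rule BFS_mono[OF N g0m fm])
    then show False using big SN[OF g0S] by simp
  qed
  moreover have "0 \<le> e" by (simp add: e_def)
  ultimately have e0: "0 < e" by simp
  \<comment> \<open>The pairing with \<open>\<phi>\<close> is at most \<open>c\<close> on the unit
    ball and equals \<open>c + e\<close> at \<open>f\<close>. The value halfway between separates
    them after division, and it is positive even if \<open>c = 0\<close>.\<close>
  define c' where "c' = c + e / 2"
  have c': "0 < c'" using c0 e0 by (simp add: c'_def)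
  define h where "h x = \<phi> x / c'" for x
  show ?thesis
  proof
    show hm: "h \<in> borel_measurable lebesgue" unfolding h_def by measurable
    show "0 \<le> h x" for x using \<phi>0 c' by (simp add: h_def)
    show "assoc N h \<le> 1" unfolding assoc_def
    proof (rule SUP_least)
      fix w assume "w \<in> {f \<in> borel_measurable lebesgue. N f = 1}"
      then have wm[measurable]: "w \<in> borel_measurable lebesgue" and "N w \<le> 1" by auto
      have "(\<integral>\<^sup>+x. ennreal \<bar>w x * h x\<bar> \<partial>lebesgue) = (\<integral>\<^sup>+x. ennreal (1 / c') * ennreal \<bar>w x * \<phi> x\<bar> \<partial>lebesgue)"
        using c' by (intro nn_integral_cong) (auto simp: h_def ennreal_mult[symmetric] abs_mult)
      also have "\<dots> = ennreal (1 / c') * (\<integral>\<^sup>+x. ennreal \<bar>w x * \<phi> x\<bar> \<partial>lebesgue)"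
        by (rule nn_integral_cmult) auto
      also have "\<dots> \<le> ennreal (1 / c') * ennreal c"
        by (intro mult_left_mono varN \<open>N w \<le> 1\<close> wm) auto
      also have "\<dots> = ennreal (c / c')" using c' c0 by (simp add: ennreal_mult[symmetric])
      also have "\<dots> \<le> 1" using c' e0 by (simp add: c'_def)
      finally show "(\<integral>\<^sup>+x. ennreal \<bar>w x * h x\<bar> \<partial>lebesgue) \<le> 1" .
    qed
    have eq: "f x * h x = (1 / c') * (\<phi> x * g0 x + (\<phi> x)\<^sup>2)" for x
      by (simp add: h_def \<phi>_def power2_eq_square algebra_simps diff_divide_distrib add_divide_distrib)
    have "(\<integral>\<^sup>+x. ennreal (f x * h x) \<partial>lebesgue) = ennreal (\<integral>x. f x * h x \<partial>lebesgue)"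
    proof (rule nn_integral_eq_integral)
      show "integrable lebesgue (\<lambda>x. f x * h x)" unfolding eq using g0i \<phi>i by simp
    qed (use f0 \<phi>0 c' in \<open>auto simp: h_def\<close>)
    also have "(\<integral>x. f x * h x \<partial>lebesgue) = (c + e) / c'"
      unfolding eq using g0i \<phi>i by (simp add: c_def e_def)
    finally show "1 < (\<integral>\<^sup>+x. ennreal (f x * h x) \<partial>lebesgue)"
      using c' e0 by (simp add: c'_def)
  qed
qed

section \<open>Recovering a norm bound from the associate space\<close>

lemma borel_measurable_lebesgueI:
  "f \<in> borel_measurable borel \<Longrightarrow> f \<in> borel_measurable lebesgue"
  by (rule measurable_completion) simp

lemma assoc_cong_AE:
  assumes "AE x in lebesgue. g x = h x"
  shows "assoc N g = assoc N h"
  unfolding assoc_def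
proof (rule SUP_cong[OF refl])
  fix f
  show "(\<integral>\<^sup>+x. ennreal \<bar>f x * g x\<bar> \<partial>lebesgue) = (\<integral>\<^sup>+x. ennreal \<bar>f x * h x\<bar> \<partial>lebesgue)"
    by (rule nn_integral_cong_AE) (use assms in eventually_elim, simp)
qed

text \<open>If the bound failed, a real \<open>C'\<close> could be put strictly between
  \<open>C\<close> and \<open>N f\<close>, even when \<open>N f\<close> is infinite. Separating
  \<open>f / C'\<close> from the unit ball then produces an \<open>h\<close> whose pairing with
  \<open>f\<close> exceeds \<open>C'\<close>. The assumption \<open>dual\<close> is asked only for
  Borel \<open>h\<close>, because the Fubini argument that supplies it works on Borel product
  spaces.\<close>

lemma BFS_assoc_assoc_le:
  fixes f :: "'a::euclidean_space \<Rightarrow> real"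
  assumes N: "ball_BFS N" and fm: "f \<in> borel_measurable lebesgue"
    and f0: "\<And>x. 0 \<le> f x" and fK: "\<And>x. f x \<le> K" and supp: "\<And>x. x \<notin> ball 0 R \<Longrightarrow> f x = 0"
    and C: "0 \<le> C"
    and dual: "\<And>h. h \<in> borel_measurable borel \<Longrightarrow> (\<And>x. 0 \<le> h x) \<Longrightarrow> assoc N h \<le> 1 \<Longrightarrow>
      (\<integral>\<^sup>+x. ennreal (f x * h x) \<partial>lebesgue) \<le> ennreal C"
  shows "N f \<le> ennreal C"
proof (rule ccontr)
  assume "\<not> N f \<le> ennreal C"
  then have "ennreal C < N f" by simp
  then obtain y where y: "ennreal C < y" "y < N f" using dense by blast
  then obtain C' where C': "y = ennreal C'" "0 \<le> C'" by (cases y) auto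
  have CC: "C < C'" using y C' C by (simp add: ennreal_less_iff)
  with C have C'0: "0 < C'" by simp
  define u where "u x = (1 / C') * f x" for x
  have um: "u \<in> borel_measurable lebesgue" unfolding u_def using fm by simp
  have "N u = ennreal (1 / C') * N f"
    unfolding u_def using BFS_scale[OF N fm, of "1 / C'"] C'0 by simp
  also have "1 < \<dots>"
  proof -
    have "1 = ennreal (1 / C') * ennreal C'" using C'0 by (simp add: ennreal_mult[symmetric])
    also have "\<dots> < ennreal (1 / C') * N f"
      by (rule ennreal_mult_strict_left_mono) (use y C' C'0 in auto)
    finally show ?thesis .
  qed
  finally have big: "1 < N u" .
  obtain h where h: "h \<in> borel_measurable lebesgue" "\<And>x. 0 \<le> h x" "assoc N h \<le> 1"
    "1 < (\<integral>\<^sup>+x. ennreal (u x * h x) \<partial>lebesgue)"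
  proof (rule BFS_separation[OF N um _ _ _ big, of "K / C'" R])
    show "u x \<le> K / C'" "0 \<le> u x" for x
      using fK[of x] f0[of x] C'0 by (auto simp: u_def divide_right_mono)
    show "x \<notin> ball 0 R \<Longrightarrow> u x = 0" for x using supp[of x] by (simp add: u_def)
  qed (rule that)
  \<comment> \<open>A Borel representative agrees with \<open>h\<close> off a null set, which
    affects neither \<open>assoc\<close> nor the integral; \<open>max 0\<close> restores
    nonnegativity at every point.\<close>
  obtain h' where h'm: "h' \<in> borel_measurable lborel" and "AE x in lborel. h x = h' x"
    using completion_ex_borel_measurable_real[OF h(1)] by blast
  then have ae: "AE x in lebesgue. h x = max 0 (h' x)"
    using h(2) by (auto intro!: AE_completion elim!: eventually_mono) (metis max.absorb2)
  have "(\<integral>\<^sup>+x. ennreal (f x * max 0 (h' x)) \<partial>lebesgue) \<le> ennreal C"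
  proof (rule dual)
    show "assoc N (\<lambda>x. max 0 (h' x)) \<le> 1" using assoc_cong_AE[OF ae, of N] h(3) by simp
  qed (use h'm in auto)
  moreover have "(\<integral>\<^sup>+x. ennreal (f x * max 0 (h' x)) \<partial>lebesgue) = ennreal C' * (\<integral>\<^sup>+x. ennreal (u x * h x) \<partial>lebesgue)"
  proof -
    have "(\<integral>\<^sup>+x. ennreal (f x * max 0 (h' x)) \<partial>lebesgue) = (\<integral>\<^sup>+x. ennreal C' * ennreal (u x * h x) \<partial>lebesgue)"
      by (rule nn_integral_cong_AE, use ae in eventually_elim)
        (use C'0 f0 h(2) in \<open>auto simp: u_def ennreal_mult[symmetric]\<close>)
    also have "\<dots> = ennreal C' * (\<integral>\<^sup>+x. ennreal (u x * h x) \<partial>lebesgue)"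
      by (rule nn_integral_cmult) (use um h(1) in auto)
    finally show ?thesis .
  qed
  moreover have "ennreal C' * 1 \<le> ennreal C' * (\<integral>\<^sup>+x. ennreal (u x * h x) \<partial>lebesgue)"
    by (rule mult_left_mono) (use h(4) in auto)
  ultimately have "ennreal C' \<le> ennreal C" by simp
  then show False using CC C C'0 by (simp add: ennreal_le_iff)
qed

text \<open>Cutting \<open>F\<close> in height and in space reduces to bounded functions with
  bounded support, and \<open>BFS_liminf_le\<close> returns to \<open>F\<close>. Finiteness is part
  of the conclusion: without it, \<open>enn2real\<close> would hide a set on which \<open>F\<close>
  is infinite.\<close>

lemma BFS_le_by_duality:
  fixes F :: "'a::euclidean_space \<Rightarrow> ennreal"
  assumes N: "ball_BFS N" and Fm[measurable]: "F \<in> borel_measurable lebesgue" and C: "0 \<le> C"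
    and dual: "\<And>h. h \<in> borel_measurable borel \<Longrightarrow> (\<And>x. 0 \<le> h x) \<Longrightarrow> assoc N h \<le> 1 \<Longrightarrow>
      (\<integral>\<^sup>+x. F x * ennreal (h x) \<partial>lebesgue) \<le> ennreal C"
  shows "AE x in lebesgue. F x < \<infinity>" "N (\<lambda>x. enn2real (F x)) \<le> ennreal C"
proof -
  define f where "f k x = enn2real (min (F x) (of_nat k)) * indicator (ball 0 (real k)) x" for k x
  have fm[measurable]: "f k \<in> borel_measurable lebesgue" for k
    unfolding f_def by (intro borel_measurable_times borel_measurable_indicator) auto
  have fin: "min (F x) (of_nat k) < top" for k x
    by (metis of_nat_less_top min.strict_coboundedI2)
  have ef: "ennreal (f k x) = min (F x) (of_nat k) * indicator (ball 0 (real k)) x" for k x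
    using fin[of x k] by (auto simp: f_def indicator_def)
  have f0: "0 \<le> f k x" for k x by (simp add: f_def)
  have fN: "N (f k) \<le> ennreal C" for k
  proof (rule BFS_assoc_assoc_le[OF N fm f0 _ _ C, where K="real k" and R="real k"])
    show "f k x \<le> real k" for x
    proof -
      have "enn2real (min (F x) (of_nat k)) \<le> enn2real (of_nat k)"
        by (rule enn2real_mono) (auto simp: of_nat_less_top)
      then show ?thesis by (auto simp: f_def indicator_def)
    qed
    fix h :: "'a \<Rightarrow> real" assume h: "h \<in> borel_measurable borel" "\<And>x. 0 \<le> h x" "assoc N h \<le> 1"
    have "(\<integral>\<^sup>+x. ennreal (f k x * h x) \<partial>lebesgue) \<le> (\<integral>\<^sup>+x. F x * ennreal (h x) \<partial>lebesgue)"
      by (intro nn_integral_mono) (auto simp: ennreal_mult f0 h ef indicator_def intro!: mult_right_mono)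
    also have "\<dots> \<le> ennreal C" by (rule dual[OF h])
    finally show "(\<integral>\<^sup>+x. ennreal (f k x * h x) \<partial>lebesgue) \<le> ennreal C" .
  qed (auto simp: f_def)
  have sup: "F x \<le> (SUP k. ennreal (f k x))" for x
  \<comment> \<open>Every \<open>y\<close> strictly below \<open>F x\<close> is finite and thus
    reached by some truncation, which treats infinite values of \<open>F x\<close> together with
    finite ones.\<close>
  proof (rule dense_le)
    fix y assume "y < F x"
    then have "y < top" using less_top_ennreal order.strict_trans2 top_greatest by blast
    then obtain k1 where k1: "y < of_nat k1" using ennreal_Ex_less_of_nat by blast
    obtain k2 where k2: "norm x < real k2" using reals_Archimedean2 by blast
    define k where "k = max k1 k2"
    have "of_nat k1 \<le> (of_nat k :: ennreal)" by (rule of_nat_mono) (simp add: k_def)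
    then have "y \<le> of_nat k" using k1 less_imp_le order_trans by blast
    moreover have "x \<in> ball 0 (real k)" using k2 by (simp add: k_def)
    ultimately have "y \<le> ennreal (f k x)" using \<open>y < F x\<close> by (simp add: ef)
    then show "y \<le> (SUP k. ennreal (f k x))" by (rule SUP_upper2[rotated]) simp
  qed
  have mono: "f k x \<le> f (Suc k) x" for k x
  proof -
    have "ennreal (f k x) \<le> ennreal (f (Suc k) x)"
      unfolding ef by (intro mult_mono min.mono) (auto simp: indicator_def intro: of_nat_mono)
    then show ?thesis using f0 by (simp add: ennreal_le_iff)
  qed
  have inc: "incseq (\<lambda>k. f k x)" for x by (rule incseq_SucI) (rule mono)
  \<comment> \<open>The local L1 axiom turns the uniform bound on \<open>N (f k)\<close> into a
    finite integral of \<open>F\<close> over each ball; countably many balls cover the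
    space.\<close>
  have "AE x in lebesgue. x \<in> ball 0 (real R) \<longrightarrow> F x < \<infinity>" for R :: nat
  proof -
    obtain D where D: "\<And>f. f \<in> borel_measurable lebesgue \<Longrightarrow> N f < \<infinity> \<Longrightarrow>
        (\<integral>\<^sup>+x\<in>ball 0 (real R). ennreal \<bar>f x\<bar> \<partial>lebesgue) \<le> ennreal D * N f"
      using BFS_local_L1[OF N] by blast
    have im[measurable]: "(\<lambda>x::'a. indicator (ball 0 (real R)) x :: ennreal) \<in> borel_measurable lebesgue"
      by (intro borel_measurable_indicator) auto
    have "(\<integral>\<^sup>+x\<in>ball 0 (real R). F x \<partial>lebesgue) \<le> (\<integral>\<^sup>+x. (SUP k. ennreal (f k x) * indicator (ball 0 (real R)) x) \<partial>lebesgue)"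
      unfolding SUP_mult_right_ennreal[symmetric] by (intro nn_integral_mono mult_right_mono sup) auto
    also have "\<dots> = (SUP k. \<integral>\<^sup>+x\<in>ball 0 (real R). ennreal (f k x) \<partial>lebesgue)"
      using inc by (intro nn_integral_monotone_convergence_SUP)
        (auto simp: incseq_def le_fun_def intro!: mult_right_mono ennreal_leI)
    also have "\<dots> \<le> ennreal D * ennreal C"
    proof (rule SUP_least)
      fix k
      have "N (f k) < \<infinity>" using fN[of k] ennreal_less_top le_less_trans by (metis infinity_ennreal_def)
      then have "(\<integral>\<^sup>+x\<in>ball 0 (real R). ennreal \<bar>f k x\<bar> \<partial>lebesgue) \<le> ennreal D * N (f k)" by (rule D[OF fm])
      also have "\<dots> \<le> ennreal D * ennreal C" by (intro mult_left_mono fN) simp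
      finally show "(\<integral>\<^sup>+x\<in>ball 0 (real R). ennreal (f k x) \<partial>lebesgue) \<le> ennreal D * ennreal C"
        using f0 by simp
    qed
    finally have "(\<integral>\<^sup>+x\<in>ball 0 (real R). F x \<partial>lebesgue) \<noteq> \<infinity>"
      by (auto simp: top_unique ennreal_mult_eq_top_iff)
    then have "AE x in lebesgue. F x * indicator (ball 0 (real R)) x \<noteq> \<infinity>"
      by (intro nn_integral_PInf_AE) measurable
    then show ?thesis by eventually_elim (auto simp: less_top)
  qed
  then have "AE x in lebesgue. \<forall>R::nat. x \<in> ball 0 (real R) \<longrightarrow> F x < \<infinity>"
    unfolding AE_all_countable by blast
  then show ae: "AE x in lebesgue. F x < \<infinity>"
  proof eventually_elim
    case (elim x)
    obtain R where "norm x < real R" using reals_Archimedean2 by blast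
    then show ?case using elim by auto
  qed
  show "N (\<lambda>x. enn2real (F x)) \<le> ennreal C"
  proof (rule BFS_liminf_le[OF N fm _ f0 fN])
    show "AE x in lebesgue. (\<lambda>k. f k x) \<longlonglongrightarrow> enn2real (F x)"
      using ae
    proof eventually_elim
      case (elim x)
      have "(SUP k. ennreal (f k x)) = F x"
      proof (rule antisym[OF SUP_least sup])
        show "ennreal (f k x) \<le> F x" for k by (simp add: ef indicator_def)
      qed
      moreover have "(\<lambda>k. ennreal (f k x)) \<longlonglongrightarrow> (SUP k. ennreal (f k x))"
        by (rule LIMSEQ_SUP) (use inc in \<open>auto simp: incseq_def intro: ennreal_leI\<close>)
      ultimately have "(\<lambda>k. ennreal (f k x)) \<longlonglongrightarrow> F x" by simp
      then have "(\<lambda>k. enn2real (ennreal (f k x))) \<longlonglongrightarrow> enn2real (F x)"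
        using elim by (intro tendsto_enn2real) (auto simp: ennreal_enn2real)
      then show ?case using f0 by simp
    qed
  qed auto
qed

subsection \<open>The maximal function and truncated Riesz kernels\<close>

lemma maximal_ball_le:
  fixes f :: "'a::euclidean_space \<Rightarrow> real"
  assumes "0 < r" "x \<in> ball c r"
  shows "(\<integral>\<^sup>+y\<in>ball c r. ennreal \<bar>f y\<bar> \<partial>lebesgue) \<le> maximal f x * emeasure lebesgue (ball c r)"
proof -
  define e where "e = emeasure lebesgue (ball c r)"
  have "emeasure lborel (ball c r) \<noteq> 0"
    using assms(1) by (simp add: emeasure_ball ennreal_eq_0_iff not_le unit_ball_vol_pos)
  then have e: "e \<noteq> 0" "e \<noteq> \<infinity>"
    using emeasure_lborel_ball_finite[of c r] by (auto simp: e_def)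
  have "(\<integral>\<^sup>+y\<in>ball c r. ennreal \<bar>f y\<bar> \<partial>lebesgue) / e \<le> maximal f x"
    unfolding maximal_def e_def by (rule SUP_upper) (use assms in auto)
  then have "(\<integral>\<^sup>+y\<in>ball c r. ennreal \<bar>f y\<bar> \<partial>lebesgue) / e * e \<le> maximal f x * e"
    by (rule mult_right_mono) simp
  then show ?thesis using e
    by (simp add: ennreal_divide_times ennreal_divide_self less_top flip: e_def)
qed

text \<open>Serves two purposes: applied to the constant 1, it reads off the mass of the truncated
  kernel, and applied to a bounded gradient, it makes the maximal function finite
  everywhere.\<close>

lemma maximal_le_const:
  fixes f :: "'a::euclidean_space \<Rightarrow> real"
  assumes "\<And>x. \<bar>f x\<bar> \<le> K"
  shows "maximal f x \<le> ennreal K"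
  unfolding maximal_def
proof (rule SUP_least, clarsimp)
  fix c :: 'a and r :: real assume "0 < r"
  define e where "e = emeasure lborel (ball c r)"
  have "e \<noteq> 0"
    using \<open>0 < r\<close> by (simp add: e_def emeasure_ball ennreal_eq_0_iff not_le unit_ball_vol_pos)
  have fin: "e \<noteq> \<infinity>"
    using emeasure_lborel_ball_finite[of c r] by (auto simp: e_def)
  have "(\<integral>\<^sup>+y\<in>ball c r. ennreal \<bar>f y\<bar> \<partial>lebesgue) \<le> (\<integral>\<^sup>+y\<in>ball c r. ennreal K \<partial>lebesgue)"
    by (intro nn_integral_mono mult_right_mono ennreal_leI assms) auto
  also have "\<dots> = ennreal K * e"
    by (subst nn_integral_cmult_indicator) (auto simp: e_def)
  finally have "(\<integral>\<^sup>+y\<in>ball c r. ennreal \<bar>f y\<bar> \<partial>lebesgue) / e \<le> ennreal K * e / e"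
    by (rule divide_right_mono_ennreal)
  also have "ennreal K * e / e = ennreal K"
    using \<open>e \<noteq> 0\<close> fin by (simp add: ennreal_times_divide[symmetric] ennreal_divide_self less_top)
  finally show "(\<integral>\<^sup>+y\<in>ball c r. ennreal \<bar>f y\<bar> \<partial>lebesgue) / emeasure lborel (ball c r) \<le> ennreal K"
    by (simp add: e_def)
qed

text \<open>The balls in \<open>maximal\<close> are open and contain \<open>x\<close> anywhere, not
  just at the centre, so a superlevel set is a union of open balls. It is open for arbitrary
  \<open>f\<close>.\<close>

lemma borel_measurable_maximal [measurable]:
  fixes f :: "'a::euclidean_space \<Rightarrow> real"
  shows "maximal f \<in> borel_measurable borel"
proof (rule borel_measurableI_greater)
  fix t
  define A where "A = {(c, r). 0 < r \<and> t < (\<integral>\<^sup>+y\<in>ball c r. ennreal \<bar>f y\<bar> \<partial>lebesgue) / emeasure lebesgue (ball c r)}"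
  have "{x \<in> space borel. t < maximal f x} = (\<Union>(c, r)\<in>A. ball c r)"
  proof safe
    fix x assume "t < maximal f x"
    then obtain c r where "0 < r" "x \<in> ball c r"
      "t < (\<integral>\<^sup>+y\<in>ball c r. ennreal \<bar>f y\<bar> \<partial>lebesgue) / emeasure lebesgue (ball c r)"
      unfolding maximal_def less_SUP_iff by blast
    then show "x \<in> (\<Union>(c, r)\<in>A. ball c r)" unfolding A_def by blast
  next
    fix x c r assume "(c, r) \<in> A" "x \<in> ball c r"
    then show "t < maximal f x"
      unfolding A_def maximal_def less_SUP_iff by blast
  qed auto
  moreover have "open \<dots>" by (rule open_UN) auto
  ultimately show "{x \<in> space borel. t < maximal f x} \<in> sets borel" by simp
qed

section \<open>Dyadic decomposition of truncated Riesz kernels\<close>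

lemma powr_log_near:
  fixes u w \<gamma> :: real
  assumes "0 < d" "0 < w" "w / 2 \<le> d powr \<gamma>" "d powr \<gamma> \<le> w" "\<gamma> \<noteq> 0"
  shows "d \<le> 2 powr (1 / \<bar>\<gamma>\<bar>) * w powr (1 / \<gamma>)" "w powr (1 / \<gamma>) \<le> 2 powr (1 / \<bar>\<gamma>\<bar>) * d"
proof -
  have "ln w - ln 2 \<le> \<gamma> * ln d"
    using assms ln_le_cancel_iff[of "w / 2" "d powr \<gamma>"] by (simp add: ln_div ln_powr)
  moreover have "\<gamma> * ln d \<le> ln w"
    using assms ln_le_cancel_iff[of "d powr \<gamma>" w] by (simp add: ln_powr)
  \<comment> \<open>In logarithmic form the two-sided hypothesis is one absolute value, and dividing
    by \<open>|\<gamma>|\<close> treats both signs of \<open>\<gamma>\<close> at once.\<close>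
  ultimately have *: "\<bar>\<gamma> * ln d - ln w\<bar> \<le> ln 2" by simp
  have "\<bar>\<gamma>\<bar> * \<bar>ln d - ln w / \<gamma>\<bar> = \<bar>\<gamma> * ln d - ln w\<bar>"
    using assms(5) by (simp add: abs_mult[symmetric] right_diff_distrib)
  then have **: "\<bar>ln d - ln w / \<gamma>\<bar> \<le> ln 2 / \<bar>\<gamma>\<bar>"
    using * assms(5) by (simp add: pos_le_divide_eq mult.commute)
  then have "ln d \<le> ln (2 powr (1 / \<bar>\<gamma>\<bar>) * w powr (1 / \<gamma>))"
    using assms by (simp add: ln_mult ln_powr abs_le_iff)
  then show "d \<le> 2 powr (1 / \<bar>\<gamma>\<bar>) * w powr (1 / \<gamma>)"
    using assms by (subst (asm) ln_le_cancel_iff) auto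
  have "ln (w powr (1 / \<gamma>)) \<le> ln (2 powr (1 / \<bar>\<gamma>\<bar>) * d)"
    using assms ** by (simp add: ln_mult ln_powr abs_le_iff)
  then show "w powr (1 / \<gamma>) \<le> 2 powr (1 / \<bar>\<gamma>\<bar>) * d"
    using assms by (subst (asm) ln_le_cancel_iff) auto
qed

lemma ex_dyadic_level:
  fixes u b :: real
  assumes "0 < u" "u < b"
  obtains k :: nat where "(1/2)^k * b / 2 \<le> u" "u \<le> (1/2)^k * b"
proof -
  have ex: "\<exists>k. (1/2)^k * b / 2 \<le> u"
  proof -
    obtain k where "(1/2::real)^k < u / b" using real_arch_pow_inv[of "u / b" "1/2"] assms by auto
    then have "(1/2)^k * b < u" using assms by (simp add: pos_less_divide_eq)
    moreover have "0 < (1/2)^k * b" using assms by simp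
    ultimately show ?thesis by (intro exI[of _ k]) linarith
  qed
  define k where "k = (LEAST k. (1/2)^k * b / 2 \<le> u)"
  have k1: "(1/2)^k * b / 2 \<le> u" unfolding k_def using ex by (rule LeastI_ex)
  have "u \<le> (1/2)^k * b"
  proof (cases k)
    case (Suc j)
    then have "\<not> ((1/2)^j * b / 2 \<le> u)" using not_less_Least[of j] by (metis k_def lessI)
    then show ?thesis using Suc by simp
  qed (use assms in simp)
  then show ?thesis using that k1 by blast
qed

text \<open>The shells are dyadic in the value of \<open>dist x y powr \<gamma>\<close>, not in the
  distance. On shell \<open>k\<close> the distance is comparable to \<open>R k\<close>, the kernel
  is at most \<open>c k\<close>, and the shell lies in a ball of radius
  \<open>2 * \<rho> * R k\<close>. The powers of \<open>R k\<close> cancel in \<open>c k\<close>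
  times the volume of that ball, leaving \<open>(1/2)^k * b\<close> up to a constant. For negative
  \<open>\<gamma>\<close> the radii grow with \<open>k\<close>, but the series is the same.\<close>

lemma riesz_kernel_le_maximal:
  fixes \<gamma> :: real
  assumes \<gamma>: "\<gamma> \<noteq> 0"
  obtains K where "0 < K" "\<And>(b::real) x (h :: 'a::euclidean_space \<Rightarrow> real). 0 \<le> b \<Longrightarrow> h \<in> borel_measurable lebesgue \<Longrightarrow>
    (\<integral>\<^sup>+y. indicator {y. y \<noteq> x \<and> dist x y powr \<gamma> < b} y * ennreal (dist x y powr (\<gamma> - DIM('a))) * ennreal \<bar>h y\<bar> \<partial>lebesgue)
      \<le> ennreal (K * b) * maximal h x"
proof
  define n where "n = DIM('a)"
  define \<rho> where "\<rho> = 2 powr (1 / \<bar>\<gamma>\<bar>)"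
  define V where "V = unit_ball_vol (real n)"
  have \<rho>: "0 < \<rho>" by (simp add: \<rho>_def)
  have V: "0 < V" by (simp add: V_def unit_ball_vol_pos)
  \<comment> \<open>The first 2 is the sum of the geometric series, \<open>(2 * \<rho>^2)^n\<close>
    is what remains of \<open>(\<rho> / R k)^n * (2 * \<rho> * R k)^n\<close>, and \<open>V\<close>
    is the volume of the unit ball.\<close>
  show "0 < 2 * (2 * \<rho>\<^sup>2)^n * V" using \<rho> V by simp
  fix b :: real and x and h :: "'a \<Rightarrow> real"
  assume b: "0 \<le> b" and hm[measurable]: "h \<in> borel_measurable lebesgue"
  define R where "R k = ((1/2)^k * b) powr (1 / \<gamma>)" for k :: nat
  define c where "c k = (1/2)^k * b * (\<rho> / R k)^n" for k
  show "(\<integral>\<^sup>+y. indicator {y. y \<noteq> x \<and> dist x y powr \<gamma> < b} y * ennreal (dist x y powr (\<gamma> - DIM('a))) * ennreal \<bar>h y\<bar> \<partial>lebesgue)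
      \<le> ennreal (2 * (2 * \<rho>\<^sup>2)^n * V * b) * maximal h x"
  proof (cases "b = 0")
    case True
    then have "{y. y \<noteq> x \<and> dist x y powr \<gamma> < b} = {}" by (auto simp: not_less)
    then show ?thesis by simp
  next
    case False
    with b have b: "0 < b" by simp
    have R: "0 < R k" for k using b by (simp add: R_def)
    have c: "0 \<le> c k" for k using b R[of k] \<rho> by (simp add: c_def)
    have bm[measurable]: "(\<lambda>y. indicator (ball x r) y :: ennreal) \<in> borel_measurable lebesgue" for r
      by (intro borel_measurable_indicator) auto
    have "(\<integral>\<^sup>+y. indicator {y. y \<noteq> x \<and> dist x y powr \<gamma> < b} y * ennreal (dist x y powr (\<gamma> - DIM('a))) * ennreal \<bar>h y\<bar> \<partial>lebesgue)
      \<le> (\<integral>\<^sup>+y. (\<Sum>k. ennreal (c k) * (ennreal \<bar>h y\<bar> * indicator (ball x (2 * \<rho> * R k)) y)) \<partial>lebesgue)"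
    proof (rule nn_integral_mono)
      fix y :: 'a
      show "indicator {y. y \<noteq> x \<and> dist x y powr \<gamma> < b} y * ennreal (dist x y powr (\<gamma> - DIM('a))) * ennreal \<bar>h y\<bar>
        \<le> (\<Sum>k. ennreal (c k) * (ennreal \<bar>h y\<bar> * indicator (ball x (2 * \<rho> * R k)) y))"
      proof (cases "y \<noteq> x \<and> dist x y powr \<gamma> < b")
        case True
        define d where "d = dist x y"
        have d: "0 < d" using True by (auto simp: d_def)
        obtain k where k: "(1/2)^k * b / 2 \<le> d powr \<gamma>" "d powr \<gamma> \<le> (1/2)^k * b"
          using ex_dyadic_level[of "d powr \<gamma>" b] True d by (auto simp: d_def)
        have near: "d \<le> \<rho> * R k" "R k \<le> \<rho> * d"
          using powr_log_near[OF d _ k \<gamma>] b by (auto simp: \<rho>_def R_def)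
        have "\<rho> * R k > 0" using \<rho> R[of k] by simp
        \<comment> \<open>The extra factor 2 in the radius absorbs the case of equality, as the ball
          is open.\<close>
        then have inb: "y \<in> ball x (2 * \<rho> * R k)" using near(1) by (simp add: d_def)
        have "d powr (\<gamma> - n) = d powr \<gamma> * (1 / d)^n"
          using d by (simp add: powr_diff powr_realpow power_divide)
        also have "\<dots> \<le> (1/2)^k * b * (\<rho> / R k)^n"
        proof (intro mult_mono k(2) power_mono)
          show "1 / d \<le> \<rho> / R k" using near(2) d R[of k] by (simp add: field_simps)
        qed (use d b in auto)
        finally have "ennreal (d powr (\<gamma> - n)) \<le> ennreal (c k)" by (simp add: c_def ennreal_leI)
        then have "ennreal (d powr (\<gamma> - n)) * ennreal \<bar>h y\<bar> \<le> ennreal (c k) * (ennreal \<bar>h y\<bar> * indicator (ball x (2 * \<rho> * R k)) y)"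
          using inb by (auto intro: mult_right_mono)
        also have "\<dots> = (\<Sum>k\<in>{k}. ennreal (c k) * (ennreal \<bar>h y\<bar> * indicator (ball x (2 * \<rho> * R k)) y))"
          by simp
        also have "\<dots> \<le> (\<Sum>k. ennreal (c k) * (ennreal \<bar>h y\<bar> * indicator (ball x (2 * \<rho> * R k)) y))"
          by (rule sum_le_suminf) auto
        finally show ?thesis using True by (simp add: d_def n_def)
      qed auto
    qed
    also have "\<dots> = (\<Sum>k. \<integral>\<^sup>+y. ennreal (c k) * (ennreal \<bar>h y\<bar> * indicator (ball x (2 * \<rho> * R k)) y) \<partial>lebesgue)"
      by (rule nn_integral_suminf) measurable
    also have "\<dots> \<le> (\<Sum>k. ennreal ((1/2)^k * (b * (2 * \<rho>\<^sup>2)^n * V)) * maximal h x)"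
    proof (rule suminf_le)
      fix k
      have r: "0 < 2 * \<rho> * R k" using \<rho> R[of k] by simp
      have "(\<integral>\<^sup>+y. ennreal (c k) * (ennreal \<bar>h y\<bar> * indicator (ball x (2 * \<rho> * R k)) y) \<partial>lebesgue)
        = ennreal (c k) * (\<integral>\<^sup>+y\<in>ball x (2 * \<rho> * R k). ennreal \<bar>h y\<bar> \<partial>lebesgue)"
        by (rule nn_integral_cmult) measurable
      also have "\<dots> \<le> ennreal (c k) * (maximal h x * emeasure lebesgue (ball x (2 * \<rho> * R k)))"
        by (intro mult_left_mono maximal_ball_le) (use r in auto)
      also have "emeasure lebesgue (ball x (2 * \<rho> * R k)) = ennreal (V * (2 * \<rho> * R k)^n)"
        using r by (simp add: emeasure_ball V_def n_def)
      also have "ennreal (c k) * (maximal h x * ennreal (V * (2 * \<rho> * R k)^n)) = ennreal (c k * (V * (2 * \<rho> * R k)^n)) * maximal h x"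
        using c[of k] V r by (simp add: ennreal_mult mult_ac)
      also have "c k * (V * (2 * \<rho> * R k)^n) = (1/2)^k * (b * ((\<rho> / R k)^n * (2 * \<rho> * R k)^n) * V)"
        by (simp add: c_def mult_ac)
      also have "(\<rho> / R k)^n * (2 * \<rho> * R k)^n = (2 * \<rho>\<^sup>2)^n"
      proof -
        have "\<rho> / R k * (2 * \<rho> * R k) = 2 * \<rho>\<^sup>2" using R[of k] by (simp add: power2_eq_square)
        then show ?thesis unfolding power_mult_distrib[symmetric] by simp
      qed
      finally show "(\<integral>\<^sup>+y. ennreal (c k) * (ennreal \<bar>h y\<bar> * indicator (ball x (2 * \<rho> * R k)) y) \<partial>lebesgue)
        \<le> ennreal ((1/2)^k * (b * (2 * \<rho>\<^sup>2)^n * V)) * maximal h x" .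
    qed auto
    also have "\<dots> = (\<Sum>k. ennreal ((1/2)^k * (b * (2 * \<rho>\<^sup>2)^n * V))) * maximal h x"
      by (rule ennreal_suminf_multc)
    also have "(\<Sum>k. ennreal ((1/2)^k * (b * (2 * \<rho>\<^sup>2)^n * V))) = ennreal (\<Sum>k. (1/2)^k * (b * (2 * \<rho>\<^sup>2)^n * V))"
    proof (rule suminf_ennreal2)
      show "summable (\<lambda>k. (1/2)^k * (b * (2 * \<rho>\<^sup>2)^n * V))"
        by (intro summable_mult2 summable_geometric) simp
    qed (use b \<rho> V in auto)
    also have "(\<Sum>k. (1/2)^k * (b * (2 * \<rho>\<^sup>2)^n * V)) = 2 * (2 * \<rho>\<^sup>2)^n * V * b"
    proof -
      have "(\<Sum>k. (1/2)^k * (b * (2 * \<rho>\<^sup>2)^n * V)) = (\<Sum>k. (1/2)^k) * (b * (2 * \<rho>\<^sup>2)^n * V)"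
        by (rule suminf_mult2[symmetric]) (intro summable_geometric, simp)
      also have "(\<Sum>k. (1/2::real)^k) = 2" by (subst suminf_geometric) auto
      finally show ?thesis by simp
    qed
    finally show ?thesis .
  qed
qed

subsection \<open>Pointwise differences\<close>

lemma pred_mem_ball [measurable (raw)]:
  assumes "f \<in> M \<rightarrow>\<^sub>M borel"
  shows "Measurable.pred M (\<lambda>x. f x \<in> ball c r)"
  by (rule pred_sets2[OF _ assms]) simp

text \<open>The substitution \<open>w = x + t *\<^sub>R (z - x)\<close> carries the ball of radius
  \<open>r\<close> to that of radius \<open>t * r\<close>. Its Jacobian \<open>t^n\<close> is also
  the ratio of the volumes, so the bound is independent of \<open>t\<close>.\<close>

lemma nn_integral_dilated_ball_le_maximal:
  fixes G :: "'a::euclidean_space \<Rightarrow> real"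
  assumes Gm[measurable]: "G \<in> borel_measurable borel" and "0 < t" "0 < r"
  shows "(\<integral>\<^sup>+z\<in>ball x r. ennreal \<bar>G (x + t *\<^sub>R (z - x))\<bar> \<partial>lborel) \<le> maximal G x * emeasure lborel (ball x r)"
proof -
  define n where "n = DIM('a)"
  define F where "F w = ennreal \<bar>G w\<bar> * indicator (ball x (t * r)) w" for w
  have Fm[measurable]: "F \<in> borel_measurable borel" unfolding F_def by measurable
  have ind: "indicator (ball x (t * r)) ((x - t *\<^sub>R x) + t *\<^sub>R z) = (indicator (ball x r) z :: ennreal)" for z
  proof -
    have "dist x ((x - t *\<^sub>R x) + t *\<^sub>R z) = norm (t *\<^sub>R (x - z))"
      unfolding dist_norm by (rule arg_cong[where f=norm]) (simp add: algebra_simps)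
    also have "\<dots> = t * dist x z" using assms by (simp add: dist_norm)
    finally show ?thesis using assms by (simp add: indicator_def)
  qed
  have FT: "F ((x - t *\<^sub>R x) + t *\<^sub>R z) = ennreal \<bar>G (x + t *\<^sub>R (z - x))\<bar> * indicator (ball x r) z" for z
    unfolding F_def ind by (simp add: algebra_simps)
  have "ennreal (t^n) * (\<integral>\<^sup>+z\<in>ball x r. ennreal \<bar>G (x + t *\<^sub>R (z - x))\<bar> \<partial>lborel)
    = (\<integral>\<^sup>+z. ennreal (t^n) * F ((x - t *\<^sub>R x) + t *\<^sub>R z) \<partial>lborel)"
    unfolding FT by (rule nn_integral_cmult[symmetric]) measurable
  also have "\<dots> = (\<integral>\<^sup>+w. F w \<partial>density (distr lborel borel (\<lambda>z. (x - t *\<^sub>R x) + t *\<^sub>R z)) (\<lambda>_. ennreal (\<bar>t\<bar>^n)))"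
    using assms by (subst nn_integral_density) (auto simp: nn_integral_distr)
  also have "\<dots> = (\<integral>\<^sup>+w. F w \<partial>lborel)"
    using lborel_affine[of t "x - t *\<^sub>R x"] assms by (simp add: n_def)
  also have "\<dots> \<le> maximal G x * emeasure lborel (ball x (t * r))"
    using maximal_ball_le[of "t * r" x x G] assms by (simp add: nn_integral_completion F_def)
  also have "\<dots> = ennreal (t^n) * (maximal G x * emeasure lborel (ball x r))"
    using assms by (simp add: emeasure_ball ennreal_mult power_mult_distrib n_def unit_ball_vol_pos less_imp_le mult_ac)
  finally show ?thesis
    using zero_less_power[OF \<open>0 < t\<close>, of n]
    by (subst (asm) ennreal_mult_le_mult_iff) (auto simp: ennreal_eq_0_iff)
qed

lemma abs_diff_le_segment_integral:
  fixes f :: "'a::euclidean_space \<Rightarrow> real"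
  assumes deriv: "\<And>x. GDERIV f x :> g x" and cont: "continuous_on UNIV g"
  shows "ennreal \<bar>f z - f x\<bar> \<le> (\<integral>\<^sup>+t\<in>{0..1}. ennreal (norm (z - x) * norm (g (x + t *\<^sub>R (z - x)))) \<partial>lborel)"
proof -
  define \<psi> where "\<psi> t = f (x + t *\<^sub>R (z - x))" for t :: real
  define \<psi>' where "\<psi>' t = (z - x) \<bullet> g (x + t *\<^sub>R (z - x))" for t :: real
  have d: "(\<psi> has_vector_derivative \<psi>' t) (at t within {0..1})" for t
  proof -
    have "((\<lambda>t. x + t *\<^sub>R (z - x)) has_derivative (\<lambda>h. h *\<^sub>R (z - x))) (at t within {0..1})"
      by (auto intro!: derivative_eq_intros)
    moreover have "(f has_derivative (\<lambda>h. h \<bullet> g (x + t *\<^sub>R (z - x)))) (at (x + t *\<^sub>R (z - x)))"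
      using deriv by (simp add: gderiv_def)
    ultimately have "((\<lambda>t. f (x + t *\<^sub>R (z - x))) has_derivative (\<lambda>h. (h *\<^sub>R (z - x)) \<bullet> g (x + t *\<^sub>R (z - x)))) (at t within {0..1})"
      by (rule has_derivative_compose)
    then show ?thesis by (simp add: has_vector_derivative_def \<psi>_def[abs_def] \<psi>'_def)
  qed
  have c: "continuous_on {0..1} \<psi>'"
    unfolding \<psi>'_def by (intro continuous_intros continuous_on_compose2[OF cont]) auto
  have hb: "has_bochner_integral lborel (\<lambda>t. indicator {0..1} t *\<^sub>R \<psi>' t) (\<psi> 1 - \<psi> 0)"
    by (rule has_bochner_integral_FTC_Icc) (use d c in auto)
  then have "ennreal (norm (\<psi> 1 - \<psi> 0)) \<le> (\<integral>\<^sup>+t. norm (indicator {0..1} t *\<^sub>R \<psi>' t) \<partial>lborel)"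
    using integral_norm_bound_ennreal[of lborel "\<lambda>t. indicator {0..1} t *\<^sub>R \<psi>' t"]
    by (simp add: has_bochner_integral_iff)
  also have "\<dots> \<le> (\<integral>\<^sup>+t\<in>{0..1}. ennreal (norm (z - x) * norm (g (x + t *\<^sub>R (z - x)))) \<partial>lborel)"
    by (rule nn_integral_mono) (auto simp: indicator_def \<psi>'_def intro!: ennreal_leI Cauchy_Schwarz_ineq2)
  finally show ?thesis by (simp add: \<psi>_def)
qed

text \<open>Integrate the segment bound over the ball and exchange the integrals. For fixed
  \<open>t\<close> the inner integral is an average of the gradient over a dilated ball with the
  same centre, bounded uniformly in \<open>t\<close>. This order of integration avoids the singular
  kernel \<open>|x - z|^(1 - n)\<close>.\<close>

lemma ball_mean_diff_le_maximal:
  fixes f :: "'a::euclidean_space \<Rightarrow> real"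
  assumes deriv: "\<And>x. GDERIV f x :> g x" and cont: "continuous_on UNIV g" and r: "0 < r"
  shows "(\<integral>\<^sup>+z\<in>ball x r. ennreal \<bar>f z - f x\<bar> \<partial>lborel)
    \<le> ennreal r * (maximal (\<lambda>z. norm (g z)) x * emeasure lborel (ball x r))"
proof -
  have gm[measurable]: "g \<in> borel_measurable borel" using cont by (rule borel_measurable_continuous_onI)
  define Q where "Q = maximal (\<lambda>z. norm (g z)) x * emeasure lborel (ball x r)"
  define \<Phi> where "\<Phi> z t = ennreal (norm (z - x) * norm (g (x + t *\<^sub>R (z - x)))) * indicator {0..1} t * indicator (ball x r) z" for z t
  have \<Phi>m[measurable]: "case_prod \<Phi> \<in> borel_measurable (lborel \<Otimes>\<^sub>M lborel)"
    unfolding \<Phi>_def[abs_def] by measurable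
  have "(\<integral>\<^sup>+z\<in>ball x r. ennreal \<bar>f z - f x\<bar> \<partial>lborel) \<le> (\<integral>\<^sup>+z. (\<integral>\<^sup>+t. \<Phi> z t \<partial>lborel) \<partial>lborel)"
  proof (rule nn_integral_mono)
    fix z
    have "ennreal \<bar>f z - f x\<bar> * indicator (ball x r) z \<le>
      (\<integral>\<^sup>+t\<in>{0..1}. ennreal (norm (z - x) * norm (g (x + t *\<^sub>R (z - x)))) \<partial>lborel) * indicator (ball x r) z"
      by (intro mult_right_mono abs_diff_le_segment_integral[OF deriv cont]) auto
    also have "\<dots> = (\<integral>\<^sup>+t. \<Phi> z t \<partial>lborel)"
      unfolding \<Phi>_def by (rule nn_integral_multc[symmetric]) measurable
    finally show "ennreal \<bar>f z - f x\<bar> * indicator (ball x r) z \<le> (\<integral>\<^sup>+t. \<Phi> z t \<partial>lborel)" .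
  qed
  also have "\<dots> = (\<integral>\<^sup>+t. (\<integral>\<^sup>+z. \<Phi> z t \<partial>lborel) \<partial>lborel)"
    by (rule lborel_pair.Fubini'[symmetric]) measurable
  also have "\<dots> \<le> (\<integral>\<^sup>+t. ennreal r * Q * indicator {0..1::real} t \<partial>lborel)"
  proof (rule nn_integral_mono_AE)
    \<comment> \<open>The dilation degenerates at \<open>t = 0\<close>, which is a null set.\<close>
    show "AE t in lborel. (\<integral>\<^sup>+z. \<Phi> z t \<partial>lborel) \<le> ennreal r * Q * indicator {0..1::real} t"
      using AE_lborel_singleton[of "0::real"]
    proof eventually_elim
      case (elim t)
      show ?case
      proof (cases "t \<in> {0..1}")
        case True
        then have t: "0 < t" using elim by simp
        have "(\<integral>\<^sup>+z. \<Phi> z t \<partial>lborel) \<le> (\<integral>\<^sup>+z. ennreal r * (ennreal \<bar>norm (g (x + t *\<^sub>R (z - x)))\<bar> * indicator (ball x r) z) \<partial>lborel)"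
        proof (rule nn_integral_mono)
          fix z
          show "\<Phi> z t \<le> ennreal r * (ennreal \<bar>norm (g (x + t *\<^sub>R (z - x)))\<bar> * indicator (ball x r) z)"
            using True r by (auto simp: \<Phi>_def indicator_def dist_norm norm_minus_commute ennreal_mult intro!: mult_right_mono ennreal_leI)
        qed
        also have "\<dots> = ennreal r * (\<integral>\<^sup>+z. ennreal \<bar>norm (g (x + t *\<^sub>R (z - x)))\<bar> * indicator (ball x r) z \<partial>lborel)"
          by (rule nn_integral_cmult) measurable
        also have "\<dots> \<le> ennreal r * Q"
          unfolding Q_def using r t by (intro mult_left_mono nn_integral_dilated_ball_le_maximal) auto
        finally show ?thesis using True by simp
      qed (simp add: \<Phi>_def)
    qed
  qed
  also have "\<dots> = ennreal r * Q" by (subst nn_integral_cmult_indicator) auto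
  finally show ?thesis by (simp add: Q_def)
qed

text \<open>Compare \<open>f x\<close> and \<open>f y\<close> with \<open>f z\<close> and average
  over \<open>z\<close> in the ball around \<open>x\<close> of radius \<open>r = dist x y\<close>.
  That ball lies in the ball around \<open>y\<close> of radius \<open>2 * r\<close>, whose volume is
  \<open>2^n\<close> times as large; radius and volume together give the factor
  \<open>2^(n + 1)\<close>.\<close>

lemma abs_diff_le_maximal:
  fixes f :: "'a::euclidean_space \<Rightarrow> real"
  assumes deriv: "\<And>x. GDERIV f x :> g x" and cont: "continuous_on UNIV g"
  shows "ennreal \<bar>f x - f y\<bar> \<le> ennreal (2 ^ Suc DIM('a) * dist x y) *
    (maximal (\<lambda>z. norm (g z)) x + maximal (\<lambda>z. norm (g z)) y)"
proof (cases "x = y")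
  case False
  define r where "r = dist x y"
  define n where "n = DIM('a)"
  define M where "M = maximal (\<lambda>z. norm (g z))"
  define e where "e = emeasure lborel (ball x r)"
  have r: "0 < r" using False by (simp add: r_def)
  have fm[measurable]: "f \<in> borel_measurable borel"
    using deriv by (intro borel_measurable_continuous_onI continuous_at_imp_continuous_on)
      (auto simp: gderiv_def intro: has_derivative_continuous)
  have e: "e \<noteq> 0" "e \<noteq> top"
    using r emeasure_lborel_ball_finite[of x r]
    by (auto simp: e_def emeasure_ball ennreal_eq_0_iff not_le unit_ball_vol_pos)
  have e2: "emeasure lborel (ball y (2 * r)) = ennreal (2^n) * e"
    using r by (simp add: e_def emeasure_ball n_def power_mult_distrib ennreal_mult[symmetric] mult_ac unit_ball_vol_pos less_imp_le)
  have sub: "ball x r \<subseteq> ball y (2 * r)"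
  proof
    fix z assume "z \<in> ball x r"
    then show "z \<in> ball y (2 * r)"
      using dist_triangle[of y z x] by (simp add: r_def dist_commute)
  qed
  have "ennreal \<bar>f x - f y\<bar> * e = (\<integral>\<^sup>+z\<in>ball x r. ennreal \<bar>f x - f y\<bar> \<partial>lborel)"
    by (subst nn_integral_cmult_indicator) (auto simp: e_def)
  also have "\<dots> \<le> (\<integral>\<^sup>+z. ennreal \<bar>f z - f x\<bar> * indicator (ball x r) z + ennreal \<bar>f z - f y\<bar> * indicator (ball y (2 * r)) z \<partial>lborel)"
  proof (rule nn_integral_mono)
    fix z
    show "ennreal \<bar>f x - f y\<bar> * indicator (ball x r) z \<le> ennreal \<bar>f z - f x\<bar> * indicator (ball x r) z + ennreal \<bar>f z - f y\<bar> * indicator (ball y (2 * r)) z"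
    proof (cases "z \<in> ball x r")
      case True
      then have "z \<in> ball y (2 * r)" using sub by blast
      moreover have "ennreal \<bar>f x - f y\<bar> \<le> ennreal \<bar>f z - f x\<bar> + ennreal \<bar>f z - f y\<bar>"
        by (simp add: ennreal_plus[symmetric] del: ennreal_plus)
      ultimately show ?thesis using True by simp
    qed simp
  qed
  also have "\<dots> = (\<integral>\<^sup>+z\<in>ball x r. ennreal \<bar>f z - f x\<bar> \<partial>lborel) + (\<integral>\<^sup>+z\<in>ball y (2 * r). ennreal \<bar>f z - f y\<bar> \<partial>lborel)"
    by (rule nn_integral_add) measurable
  also have "\<dots> \<le> ennreal r * (M x * e) + ennreal (2 * r) * (M y * (ennreal (2^n) * e))"
    unfolding M_def e2[symmetric] unfolding e_def
    using r by (intro add_mono ball_mean_diff_le_maximal[OF deriv cont]) auto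
  also have "\<dots> = (ennreal r * M x + ennreal (2^Suc n * r) * M y) * e"
    using r by (simp add: distrib_left distrib_right ennreal_mult mult_ac)
  also have "\<dots> \<le> (ennreal (2^Suc n * r) * M x + ennreal (2^Suc n * r) * M y) * e"
  proof (intro mult_right_mono add_mono ennreal_leI)
    have "1 * r \<le> 2^Suc n * r" using r by (intro mult_right_mono one_le_power) auto
    then show "r \<le> 2^Suc n * r" by simp
  qed (use r in auto)
  finally have "e * ennreal \<bar>f x - f y\<bar> \<le> e * (ennreal (2^Suc n * r) * (M x + M y))"
    by (simp add: mult.commute distrib_left distrib_right)
  then show ?thesis
    using e by (subst (asm) ennreal_mult_le_mult_iff) (auto simp: M_def r_def n_def)
qed simp

subsection \<open>The level sets and the estimate\<close>

text \<open>The infimum is attained, because the norm inequality is closed in \<open>C\<close> and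
  finiteness almost everywhere does not involve \<open>C\<close>. After division by the norm of
  \<open>f\<close>, unless it is 0, the infimum can be taken on the right.\<close>

lemma M_bounded_by_Mnorm:
  assumes "M_bounded N"
  shows "M_bounded_by N (Mnorm N)"
proof -
  define S where "S = {C. M_bounded_by N C}"
  have ne: "S \<noteq> {}" using assms by (auto simp: M_bounded_def S_def)
  have S0: "C \<in> S \<Longrightarrow> 0 \<le> C" for C by (simp add: S_def M_bounded_by_def)
  then have bdd: "bdd_below S" by (meson bdd_belowI)
  have A0: "0 \<le> Inf S" using ne S0 by (intro cInf_greatest) auto
  have "N (\<lambda>x. enn2real (maximal f x)) \<le> ennreal (Inf S) * N f"
    if f: "f \<in> borel_measurable lebesgue" "N f < \<infinity>" for f
  proof -
    obtain v where v: "N f = ennreal v" "0 \<le> v" using f(2) by (cases "N f") auto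
    have le: "N (\<lambda>x. enn2real (maximal f x)) \<le> ennreal (C * v)" if "C \<in> S" for C
    proof -
      have "N (\<lambda>x. enn2real (maximal f x)) \<le> ennreal C * N f"
        using that f unfolding S_def M_bounded_by_def by blast
      then show ?thesis using v S0[OF that] by (simp add: ennreal_mult)
    qed
    obtain w where w: "N (\<lambda>x. enn2real (maximal f x)) = ennreal w" "0 \<le> w"
      using le ne by (cases "N (\<lambda>x. enn2real (maximal f x))") (auto simp: top_unique)
    have wC: "w \<le> C * v" if "C \<in> S" for C
      using le[OF that] w v S0[OF that] by (simp add: ennreal_le_iff)
    have "w \<le> Inf S * v"
    proof (cases "v = 0")
      case False
      then have "w / v \<le> Inf S"
        using wC v by (intro cInf_greatest ne) (simp add: pos_divide_le_eq)
      then show ?thesis using v False by (simp add: pos_divide_le_eq)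
    qed (use wC ne in auto)
    then show ?thesis using w v A0 by (simp add: ennreal_mult[symmetric] ennreal_leI)
  qed
  moreover have "AE x in lebesgue. maximal f x < \<infinity>" if "f \<in> borel_measurable lebesgue" "N f < \<infinity>" for f
    using assms that unfolding M_bounded_def M_bounded_by_def by blast
  ultimately show ?thesis using A0 unfolding M_bounded_by_def Mnorm_def S_def by blast
qed

text \<open>As \<open>(u^p)^(1/p) = u\<close> for \<open>u \<ge> 0\<close>, the norm of
  \<open>u^p\<close> in the convexified space is the p-th power of the norm of \<open>u\<close>.
  This is the way from X to Y; \<open>le_of_convexify_le\<close> leads back.\<close>

lemma convexify_powr_le:
  assumes u: "\<And>x. 0 \<le> u x" and p: "0 < p" and le: "N u \<le> ennreal a" and a: "0 \<le> a"
  shows "convexify N (1 / p) (\<lambda>x. u x powr p) \<le> ennreal (a powr p)"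
proof -
  have eq: "N (\<lambda>x. (u x powr p) powr (1 / p)) = N u"
    using u p by (simp add: powr_powr)
  obtain v where "N u = ennreal v" "0 \<le> v" using le by (cases "N u") (auto simp: top_unique)
  then show ?thesis using le a p
    by (simp add: convexify_def eq ennreal_le_iff powr_mono2 ennreal_leI)
qed

lemma le_of_convexify_le:
  assumes w: "\<And>x. 0 \<le> w x" and p: "0 < p" and le: "convexify N (1 / p) w \<le> ennreal c" and c: "0 \<le> c"
  shows "N (\<lambda>x. w x powr (1 / p)) \<le> ennreal (c powr (1 / p))"
proof -
  have eq: "(\<lambda>x. \<bar>w x\<bar> powr (1 / p)) = (\<lambda>x. w x powr (1 / p))" using w by simp
  have "N (\<lambda>x. w x powr (1 / p)) \<noteq> \<infinity>"
    using le by (auto simp: convexify_def eq top_unique)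
  then obtain v where v: "N (\<lambda>x. w x powr (1 / p)) = ennreal v" "0 \<le> v"
    by (cases "N (\<lambda>x. w x powr (1 / p))") auto
  then have "v powr p \<le> c" using le c by (simp add: convexify_def eq ennreal_le_iff)
  then have "(v powr p) powr (1 / p) \<le> c powr (1 / p)" using p by (intro powr_mono2) auto
  then show ?thesis using v p by (simp add: powr_powr ennreal_leI)
qed

section \<open>Measurability of level sets and integral bounds on them\<close>

lemma sets_Eset:
  fixes f :: "'a::euclidean_space \<Rightarrow> real"
  assumes [measurable]: "f \<in> borel_measurable borel"
  shows "Eset lam \<beta> f \<in> sets (borel \<Otimes>\<^sub>M borel)"
proof -
  have "Eset lam \<beta> f = {z \<in> space (borel \<Otimes>\<^sub>M borel). fst z \<noteq> snd z \<and>
      \<bar>f (fst z) - f (snd z)\<bar> / dist (fst z) (snd z) powr (1 + \<beta>) > lam}"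
    by (auto simp: Eset_def space_pair_measure)
  also have "\<dots> \<in> sets (borel \<Otimes>\<^sub>M borel)" by measurable
  finally show ?thesis .
qed

lemma borel_measurable_riesz_kernel:
  fixes E :: "('a::euclidean_space \<times> 'a) set"
  assumes [measurable]: "E \<in> sets (borel \<Otimes>\<^sub>M borel)"
  shows "(\<lambda>(x, y). indicator E (x, y) * ennreal (dist x y powr c)) \<in> borel_measurable (borel \<Otimes>\<^sub>M borel)"
  by measurable

lemma borel_measurable_riesz_fun:
  fixes E :: "('a::euclidean_space \<times> 'a) set"
  assumes "E \<in> sets (borel \<Otimes>\<^sub>M borel)"
  shows "riesz_fun E \<gamma> \<in> borel_measurable borel"
proof -
  have "(\<lambda>x. \<integral>\<^sup>+y. indicator E (x, y) * ennreal (dist x y powr (\<gamma> - real DIM('a))) \<partial>lborel) \<in> borel_measurable borel"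
    by (rule lborel.borel_measurable_nn_integral) (use borel_measurable_riesz_kernel[OF assms] in simp)
  then show ?thesis unfolding riesz_fun_def[abs_def] nn_integral_completion .
qed

text \<open>The two alternatives are treated asymmetrically. Where \<open>b x\<close> controls the
  distance, the inner integral in \<open>y\<close> is at most \<open>K * b x\<close>, and
  \<open>h x\<close> remains a factor outside. Where \<open>b y\<close> does, the integrals are
  exchanged and the symmetric kernel, centred at \<open>y\<close>, is integrated in \<open>x\<close>
  against \<open>h\<close>, which produces \<open>maximal h y\<close>.\<close>

lemma nn_integral_riesz_fun_le:
  fixes \<gamma> :: real
  assumes \<gamma>: "\<gamma> \<noteq> 0"
  obtains K where "0 < K" "\<And>(E :: ('a::euclidean_space \<times> 'a) set) b h.
    E \<in> sets (borel \<Otimes>\<^sub>M borel) \<Longrightarrow> b \<in> borel_measurable borel \<Longrightarrow> h \<in> borel_measurable borel \<Longrightarrow>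
    (\<And>x. 0 \<le> b x) \<Longrightarrow> (\<And>x. 0 \<le> h x) \<Longrightarrow>
    (\<And>x y. (x, y) \<in> E \<Longrightarrow> x \<noteq> y \<and> (dist x y powr \<gamma> < b x \<or> dist x y powr \<gamma> < b y)) \<Longrightarrow>
    (\<integral>\<^sup>+x. riesz_fun E \<gamma> x * ennreal (h x) \<partial>lebesgue)
      \<le> ennreal K * ((\<integral>\<^sup>+x. ennreal (b x) * ennreal (h x) \<partial>lebesgue) + (\<integral>\<^sup>+x. ennreal (b x) * maximal h x \<partial>lebesgue))"
proof -
  obtain K where K: "0 < K" and kern: "\<And>(b::real) x (h :: 'a \<Rightarrow> real). 0 \<le> b \<Longrightarrow> h \<in> borel_measurable lebesgue \<Longrightarrow>
    (\<integral>\<^sup>+y. indicator {y. y \<noteq> x \<and> dist x y powr \<gamma> < b} y * ennreal (dist x y powr (\<gamma> - DIM('a))) * ennreal \<bar>h y\<bar> \<partial>lebesgue)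
      \<le> ennreal (K * b) * maximal h x"
    using riesz_kernel_le_maximal[OF \<gamma>] by blast
  show ?thesis
  proof (rule that[OF K])
    fix E :: "('a \<times> 'a) set" and b h :: "'a \<Rightarrow> real"
    assume [measurable]: "E \<in> sets (borel \<Otimes>\<^sub>M borel)" "b \<in> borel_measurable borel" "h \<in> borel_measurable borel"
      and b: "\<And>x. 0 \<le> b x" and h: "\<And>x. 0 \<le> h x"
      and E: "\<And>x y. (x, y) \<in> E \<Longrightarrow> x \<noteq> y \<and> (dist x y powr \<gamma> < b x \<or> dist x y powr \<gamma> < b y)"
    define k where "k x y = ennreal (dist x y powr (\<gamma> - DIM('a)))" for x y :: 'a
    define T where "T x y = indicator {y. y \<noteq> x \<and> dist x y powr \<gamma> < b y} y * k x y" for x y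
    have km[measurable]: "(\<lambda>(x, y). k x y) \<in> borel_measurable (borel \<Otimes>\<^sub>M borel)"
      unfolding k_def by measurable
    have Tm[measurable]: "(\<lambda>(x, y). T x y) \<in> borel_measurable (borel \<Otimes>\<^sub>M borel)"
    proof -
      have "(\<lambda>(x, y). T x y) = (\<lambda>z. indicator {z \<in> space (borel \<Otimes>\<^sub>M borel). snd z \<noteq> fst z \<and> dist (fst z) (snd z) powr \<gamma> < b (snd z)} z * k (fst z) (snd z))"
        by (auto simp: T_def indicator_def space_pair_measure)
      also have "\<dots> \<in> borel_measurable (borel \<Otimes>\<^sub>M borel)" by measurable
      finally show ?thesis .
    qed
    have pt: "riesz_fun E \<gamma> x \<le> ennreal K * ennreal (b x) + (\<integral>\<^sup>+y. T x y \<partial>lborel)" for x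
    proof -
      have "riesz_fun E \<gamma> x \<le> (\<integral>\<^sup>+y. indicator {y. y \<noteq> x \<and> dist x y powr \<gamma> < b x} y * k x y * ennreal \<bar>1\<bar> + T x y \<partial>lborel)"
        unfolding riesz_fun_def nn_integral_completion
        by (rule nn_integral_mono) (use E in \<open>auto simp: indicator_def T_def k_def\<close>)
      also have "\<dots> = (\<integral>\<^sup>+y. indicator {y. y \<noteq> x \<and> dist x y powr \<gamma> < b x} y * k x y * ennreal \<bar>1\<bar> \<partial>lborel) + (\<integral>\<^sup>+y. T x y \<partial>lborel)"
      proof (rule nn_integral_add)
        have "{y. y \<noteq> x \<and> dist x y powr \<gamma> < b x} = {y \<in> space borel. y \<noteq> x \<and> dist x y powr \<gamma> < b x}" by simp
        also have "\<dots> \<in> sets borel" by measurable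
        finally have [measurable]: "{y. y \<noteq> x \<and> dist x y powr \<gamma> < b x} \<in> sets borel" .
        show "(\<lambda>y. indicator {y. y \<noteq> x \<and> dist x y powr \<gamma> < b x} y * k x y * ennreal \<bar>1\<bar>) \<in> borel_measurable lborel"
          by measurable
      qed measurable
      also have "(\<integral>\<^sup>+y. indicator {y. y \<noteq> x \<and> dist x y powr \<gamma> < b x} y * k x y * ennreal \<bar>1\<bar> \<partial>lborel) \<le> ennreal (K * b x) * maximal (\<lambda>x. 1) x"
        \<comment> \<open>The kernel estimate against the constant 1, whose maximal function is at
          most 1, gives the mass of the kernel.\<close>
        using kern[OF b, of "\<lambda>x. 1" x x] by (simp add: k_def nn_integral_completion)
      also have "\<dots> \<le> ennreal (K * b x) * ennreal 1"
        by (intro mult_left_mono maximal_le_const) auto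
      also have "\<dots> = ennreal K * ennreal (b x)" using K b by (simp add: ennreal_mult)
      finally show ?thesis by (simp add: add_right_mono)
    qed
    have "(\<integral>\<^sup>+x. riesz_fun E \<gamma> x * ennreal (h x) \<partial>lebesgue)
      \<le> (\<integral>\<^sup>+x. ennreal K * (ennreal (b x) * ennreal (h x)) + (\<integral>\<^sup>+y. T x y \<partial>lborel) * ennreal (h x) \<partial>lborel)"
      unfolding nn_integral_completion
      by (intro nn_integral_mono order_trans[OF mult_right_mono[OF pt]]) (auto simp: distrib_left distrib_right mult_ac)
    also have "\<dots> = (\<integral>\<^sup>+x. ennreal K * (ennreal (b x) * ennreal (h x)) \<partial>lborel) + (\<integral>\<^sup>+x. (\<integral>\<^sup>+y. T x y \<partial>lborel) * ennreal (h x) \<partial>lborel)"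
      by (rule nn_integral_add) measurable
    also have "(\<integral>\<^sup>+x. ennreal K * (ennreal (b x) * ennreal (h x)) \<partial>lborel) = ennreal K * (\<integral>\<^sup>+x. ennreal (b x) * ennreal (h x) \<partial>lebesgue)"
      unfolding nn_integral_completion by (rule nn_integral_cmult) measurable
    also have "(\<integral>\<^sup>+x. (\<integral>\<^sup>+y. T x y \<partial>lborel) * ennreal (h x) \<partial>lborel) = (\<integral>\<^sup>+x. (\<integral>\<^sup>+y. T x y * ennreal (h x) \<partial>lborel) \<partial>lborel)"
      by (intro nn_integral_cong nn_integral_multc[symmetric]) measurable
    also have "\<dots> = (\<integral>\<^sup>+y. (\<integral>\<^sup>+x. T x y * ennreal (h x) \<partial>lborel) \<partial>lborel)"
      by (rule lborel_pair.Fubini'[symmetric]) measurable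
    also have "\<dots> \<le> (\<integral>\<^sup>+y. ennreal K * (ennreal (b y) * maximal h y) \<partial>lborel)"
    proof (rule nn_integral_mono)
      fix y
      have "(\<integral>\<^sup>+x. T x y * ennreal (h x) \<partial>lborel) = (\<integral>\<^sup>+x. indicator {x. x \<noteq> y \<and> dist y x powr \<gamma> < b y} x * ennreal (dist y x powr (\<gamma> - DIM('a))) * ennreal \<bar>h x\<bar> \<partial>lborel)"
        using h by (intro nn_integral_cong) (auto simp: T_def k_def indicator_def dist_commute)
      also have "\<dots> \<le> ennreal (K * b y) * maximal h y"
        using kern[OF b, of h y y] by (simp add: nn_integral_completion borel_measurable_lebesgueI)
      finally show "(\<integral>\<^sup>+x. T x y * ennreal (h x) \<partial>lborel) \<le> ennreal K * (ennreal (b y) * maximal h y)"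
        using K b by (simp add: ennreal_mult mult_ac)
    qed
    also have "\<dots> = ennreal K * (\<integral>\<^sup>+x. ennreal (b x) * maximal h x \<partial>lebesgue)"
      unfolding nn_integral_completion by (rule nn_integral_cmult) measurable
    finally show "(\<integral>\<^sup>+x. riesz_fun E \<gamma> x * ennreal (h x) \<partial>lebesgue)
      \<le> ennreal K * ((\<integral>\<^sup>+x. ennreal (b x) * ennreal (h x) \<partial>lebesgue) + (\<integral>\<^sup>+x. ennreal (b x) * maximal h x \<partial>lebesgue))"
      by (simp add: distrib_left add_left_mono)
  qed
qed

text \<open>Cut at \<open>dist x y powr \<gamma> = c\<close>. Below \<open>c\<close> the kernel has
  mass at most \<open>K * c\<close>. Above it, \<open>d^(\<gamma> - n)\<close> is
  \<open>(d^\<gamma>)^(1 - s)\<close> times \<open>d^(\<gamma> * s - n)\<close>, and the first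
  factor is at most \<open>c powr (1 - s)\<close> because \<open>1 - s \<le> 0\<close>. The cut is
  then chosen according to the value \<open>v\<close> of the other integral.\<close>

lemma riesz_fun_change_exponent:
  fixes \<gamma> s :: real
  assumes \<gamma>: "\<gamma> \<noteq> 0" and s: "1 \<le> s"
  obtains K where "0 < K" "\<And>(E :: ('a::euclidean_space \<times> 'a) set) x.
    E \<in> sets (borel \<Otimes>\<^sub>M borel) \<Longrightarrow> (\<And>x. (x, x) \<notin> E) \<Longrightarrow> riesz_fun E (\<gamma> * s) x < \<infinity> \<Longrightarrow>
    riesz_fun E \<gamma> x \<le> ennreal (K * enn2real (riesz_fun E (\<gamma> * s) x) powr (1 / s))"
proof -
  obtain K where K: "0 < K" and kern: "\<And>(b::real) x (h :: 'a \<Rightarrow> real). 0 \<le> b \<Longrightarrow> h \<in> borel_measurable lebesgue \<Longrightarrow>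
    (\<integral>\<^sup>+y. indicator {y. y \<noteq> x \<and> dist x y powr \<gamma> < b} y * ennreal (dist x y powr (\<gamma> - DIM('a))) * ennreal \<bar>h y\<bar> \<partial>lebesgue)
      \<le> ennreal (K * b) * maximal h x"
    using riesz_kernel_le_maximal[OF \<gamma>] by blast
  show ?thesis
  proof (rule that[of "K + 1"])
    fix E :: "('a \<times> 'a) set" and x
    assume [measurable]: "E \<in> sets (borel \<Otimes>\<^sub>M borel)" and diag: "\<And>x. (x, x) \<notin> E"
      and fin: "riesz_fun E (\<gamma> * s) x < \<infinity>"
    define v where "v = enn2real (riesz_fun E (\<gamma> * s) x)"
    have v: "riesz_fun E (\<gamma> * s) x = ennreal v" "0 \<le> v" using fin by (auto simp: v_def)
    define S where "S c = {y. y \<noteq> x \<and> dist x y powr \<gamma> < c}" for c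
    have Sm[measurable]: "S c \<in> sets borel" for c
    proof -
      have "S c = {y \<in> space borel. y \<noteq> x \<and> dist x y powr \<gamma> < c}" by (simp add: S_def)
      also have "\<dots> \<in> sets borel" by measurable
      finally show ?thesis .
    qed
    have split: "riesz_fun E \<gamma> x \<le> ennreal (K * c + c powr (1 - s) * v)" if c: "0 < c" for c
    proof -
      have "riesz_fun E \<gamma> x \<le> (\<integral>\<^sup>+y. indicator (S c) y * ennreal (dist x y powr (\<gamma> - DIM('a))) * ennreal \<bar>1\<bar>
         + ennreal (c powr (1 - s)) * (indicator E (x, y) * ennreal (dist x y powr (\<gamma> * s - DIM('a)))) \<partial>lborel)"
        unfolding riesz_fun_def nn_integral_completion
      proof (rule nn_integral_mono)
        fix y
        show "indicator E (x, y) * ennreal (dist x y powr (\<gamma> - DIM('a))) \<le> indicator (S c) y * ennreal (dist x y powr (\<gamma> - DIM('a))) * ennreal \<bar>1\<bar>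
         + ennreal (c powr (1 - s)) * (indicator E (x, y) * ennreal (dist x y powr (\<gamma> * s - DIM('a))))"
        proof (cases "(x, y) \<in> E \<and> y \<notin> S c")
          case True
          define d where "d = dist x y"
          have d: "0 < d" using True diag by (auto simp: d_def)
          have "c \<le> d powr \<gamma>" using True d by (auto simp: S_def d_def)
          then have "(d powr \<gamma>) powr (1 - s) \<le> c powr (1 - s)"
            using c s by (intro powr_mono2') auto
          then have "(d powr \<gamma>) powr (1 - s) * d powr (\<gamma> * s - DIM('a)) \<le> c powr (1 - s) * d powr (\<gamma> * s - DIM('a))"
            by (rule mult_right_mono) simp
          also have "(d powr \<gamma>) powr (1 - s) * d powr (\<gamma> * s - DIM('a)) = d powr (\<gamma> - DIM('a))"
            by (simp add: powr_powr powr_add[symmetric] algebra_simps)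
          finally have "ennreal (d powr (\<gamma> - DIM('a))) \<le> ennreal (c powr (1 - s)) * ennreal (d powr (\<gamma> * s - DIM('a)))"
            by (simp add: ennreal_mult[symmetric] ennreal_leI)
          then show ?thesis using True by (simp add: d_def)
        qed (auto simp: indicator_def)
      qed
      also have "\<dots> = (\<integral>\<^sup>+y. indicator (S c) y * ennreal (dist x y powr (\<gamma> - DIM('a))) * ennreal \<bar>1\<bar> \<partial>lborel)
         + (\<integral>\<^sup>+y. ennreal (c powr (1 - s)) * (indicator E (x, y) * ennreal (dist x y powr (\<gamma> * s - DIM('a)))) \<partial>lborel)"
        by (rule nn_integral_add) measurable
      also have "(\<integral>\<^sup>+y. ennreal (c powr (1 - s)) * (indicator E (x, y) * ennreal (dist x y powr (\<gamma> * s - DIM('a)))) \<partial>lborel)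
        = ennreal (c powr (1 - s)) * riesz_fun E (\<gamma> * s) x"
        unfolding riesz_fun_def nn_integral_completion by (rule nn_integral_cmult) measurable
      also have "(\<integral>\<^sup>+y. indicator (S c) y * ennreal (dist x y powr (\<gamma> - DIM('a))) * ennreal \<bar>1\<bar> \<partial>lborel) \<le> ennreal (K * c) * maximal (\<lambda>x. 1) x"
        using kern[of c "\<lambda>x. 1" x] c by (simp add: S_def nn_integral_completion)
      also have "\<dots> \<le> ennreal (K * c) * ennreal 1"
        by (intro mult_left_mono maximal_le_const) auto
      finally show ?thesis using v K c
        by (simp add: ennreal_mult add_right_mono)
    qed
    have "riesz_fun E \<gamma> x \<le> ennreal ((K + 1) * v powr (1 / s))"
    proof (cases "v = 0")
      case False
      then have v0: "0 < v" using v by simp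
      \<comment> \<open>At \<open>c = v powr (1 / s)\<close> both terms are multiples of
        \<open>v powr (1 / s)\<close>, with coefficients \<open>K\<close> and 1.\<close>
      have "(v powr (1 / s)) powr (1 - s) * v = v powr (1 / s)"
      proof -
        have "(v powr (1 / s)) powr (1 - s) * v = v powr ((1 / s) * (1 - s)) * v powr 1"
          using v0 by (simp add: powr_powr)
        also have "\<dots> = v powr (1 / s)"
          unfolding powr_add[symmetric] using s by (simp add: field_simps)
        finally show ?thesis .
      qed
      then show ?thesis using split[of "v powr (1 / s)"] v0 by (simp add: distrib_right)
    next
      case True
      \<comment> \<open>For \<open>v = 0\<close> only \<open>K * c\<close> remains, and
        \<open>c = e / K\<close> makes it an arbitrary \<open>e\<close>.\<close>
      have "riesz_fun E \<gamma> x \<le> 0"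
      proof (rule ennreal_le_epsilon)
        fix e :: real assume "0 < e"
        then show "riesz_fun E \<gamma> x \<le> 0 + ennreal e" using split[of "e / K"] K True by simp
      qed
      then show ?thesis by simp
    qed
    then show "riesz_fun E \<gamma> x \<le> ennreal ((K + 1) * enn2real (riesz_fun E (\<gamma> * s) x) powr (1 / s))"
      by (simp add: v_def)
  qed (use K in simp)
qed

text \<open>Dividing the difference bound by \<open>dist x y\<close> and by \<open>lam\<close>
  leaves \<open>dist x y powr (\<gamma> / p)\<close> below a multiple of the sum of two maximal
  functions. One of the two is at least half the sum; this 2 and the \<open>2^(n + 1)\<close> of the
  difference bound make up \<open>2^(n + 2)\<close>. The power \<open>p\<close> removes the
  denominator of the exponent.\<close>

lemma Eset_subset:
  fixes f :: "'a::euclidean_space \<Rightarrow> real"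
  assumes deriv: "\<And>x. GDERIV f x :> g x" and cont: "continuous_on UNIV g"
    and fin: "\<And>x. maximal (\<lambda>z. norm (g z)) x < \<infinity>"
    and lam: "0 < lam" and p: "0 < p" and E: "(x, y) \<in> Eset lam (\<gamma> / p) f"
  defines "b \<equiv> \<lambda>x. (2 ^ Suc (Suc DIM('a)) / lam * enn2real (maximal (\<lambda>z. norm (g z)) x)) powr p"
  shows "x \<noteq> y \<and> (dist x y powr \<gamma> < b x \<or> dist x y powr \<gamma> < b y)"
proof -
  define m where "m x = enn2real (maximal (\<lambda>z. norm (g z)) x)" for x
  define c where "c = (2::real) ^ Suc DIM('a)"
  define d where "d = dist x y"
  have m: "maximal (\<lambda>z. norm (g z)) x = ennreal (m x)" "0 \<le> m x" for x
    using fin[of x] by (auto simp: m_def)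
  have xy: "x \<noteq> y" and gt: "lam < \<bar>f x - f y\<bar> / d powr (1 + \<gamma> / p)"
    using E by (auto simp: Eset_def d_def)
  have d: "0 < d" using xy by (simp add: d_def)
  have c: "0 < c" by (simp add: c_def)
  have "ennreal \<bar>f x - f y\<bar> \<le> ennreal (c * d * (m x + m y))"
    using abs_diff_le_maximal[OF deriv cont, of x y] m c d
    by (simp add: c_def d_def ennreal_mult ennreal_plus[symmetric] del: ennreal_plus)
  then have "\<bar>f x - f y\<bar> \<le> c * d * (m x + m y)"
    using m c d by (subst (asm) ennreal_le_iff) auto
  moreover have "lam * (d powr (\<gamma> / p) * d) < \<bar>f x - f y\<bar>"
    using gt d by (simp add: pos_less_divide_eq powr_add mult_ac)
  moreover have "c * d * (m x + m y) \<le> c * d * (2 * max (m x) (m y))"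
    using c d by (intro mult_left_mono) auto
  ultimately have "d * (lam * d powr (\<gamma> / p)) < d * (2 * c * max (m x) (m y))"
    by (simp add: mult_ac)
  then have "d powr (\<gamma> / p) < 2 * c / lam * max (m x) (m y)"
    using d lam by (simp add: pos_less_divide_eq mult_ac)
  then have "(d powr (\<gamma> / p)) powr p < (2 * c / lam * max (m x) (m y)) powr p"
    using p by (intro powr_less_mono2) auto
  then have "d powr \<gamma> < (2 * c / lam * max (m x) (m y)) powr p"
    using p by (simp add: powr_powr)
  then show ?thesis
    using xy by (auto simp: b_def d_def m_def c_def max_def split: if_splits)
qed

text \<open>Finite norm admits the gradient to the maximal inequality on X; the uniform bound makes
  its maximal function finite at every point.\<close>

lemma continuous_bounded_support_norm_finite:
  fixes g :: "'a::euclidean_space \<Rightarrow> 'a"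
  assumes N: "ball_BFS N" and cont: "continuous_on UNIV g" and supp: "bounded {x. g x \<noteq> 0}"
  obtains K where "\<And>x. norm (g x) \<le> K" "N (\<lambda>x. norm (g x)) < \<infinity>"
proof -
  obtain R where R: "\<And>x. g x \<noteq> 0 \<Longrightarrow> norm x \<le> R" using supp by (auto simp: bounded_iff)
  have "compact (g ` cball 0 R)"
    by (intro compact_continuous_image continuous_on_subset[OF cont]) auto
  then obtain K where K: "\<And>x. x \<in> cball 0 R \<Longrightarrow> norm (g x) \<le> K" "0 < K"
    using compact_imp_bounded by (metis bounded_pos imageI)
  have gK: "norm (g x) \<le> K" for x
    using K(1)[of x] K(2) R[of x] by (cases "g x = 0") auto
  have gm: "(\<lambda>x. norm (g x)) \<in> borel_measurable lebesgue"
    by (intro borel_measurable_lebesgueI borel_measurable_continuous_onI continuous_on_norm cont)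
  have im: "(indicator (ball (0::'a) (R + 1)) :: 'a \<Rightarrow> real) \<in> borel_measurable lebesgue"
    by (intro borel_measurable_indicator) auto
  have "N (\<lambda>x. norm (g x)) \<le> N (\<lambda>x. K * indicator (ball 0 (R + 1)) x)"
  proof (rule BFS_mono[OF N _ gm])
    show "(\<lambda>x. K * indicator (ball (0::'a) (R + 1)) x) \<in> borel_measurable lebesgue"
      using im by (intro borel_measurable_times borel_measurable_const)
    show "AE x in lebesgue. \<bar>norm (g x)\<bar> \<le> \<bar>K * indicator (ball 0 (R + 1)) x\<bar>"
    proof (rule AE_I2)
      fix x show "\<bar>norm (g x)\<bar> \<le> \<bar>K * indicator (ball 0 (R + 1)) x\<bar>"
        using gK[of x] R[of x] K(2) by (cases "g x = 0") (auto simp: indicator_def)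
    qed
  qed
  also have "\<dots> = ennreal \<bar>K\<bar> * N (indicator (ball 0 (R + 1)))"
    by (rule BFS_scale[OF N im])
  also have "\<dots> < \<infinity>"
    using BFS_ball_finite[OF N, of 0 "R + 1"] by (simp add: ennreal_mult_less_top)
  finally show ?thesis using that gK by blast
qed

text \<open>This is the case of equal exponents. \<open>L\<close> is obtained before the norm, the
  function and \<open>lam\<close>, so it depends on \<open>\<gamma>\<close>, \<open>p\<close> and
  the dimension alone.\<close>

lemma weak_gradient_estimate:
  fixes p \<gamma> :: real
  assumes \<gamma>: "\<gamma> \<noteq> 0" and p: "1 \<le> p"
  obtains L where "0 < L" "\<And>(N :: ('n::euclidean_space \<Rightarrow> real) \<Rightarrow> ennreal) f g lam.
    ball_BFS N \<Longrightarrow> ball_BFS (convexify N (1 / p)) \<Longrightarrow>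
    M_bounded N \<Longrightarrow> M_bounded (assoc (convexify N (1 / p))) \<Longrightarrow>
    (\<And>x. GDERIV f x :> g x) \<Longrightarrow> continuous_on UNIV g \<Longrightarrow> bounded {x. g x \<noteq> 0} \<Longrightarrow> 0 < lam \<Longrightarrow>
    (AE x in lebesgue. riesz_fun (Eset lam (\<gamma> / p) f) \<gamma> x < \<infinity>) \<and>
    N (\<lambda>x. enn2real (riesz_fun (Eset lam (\<gamma> / p) f) \<gamma> x) powr (1 / p))
      \<le> ennreal (L * Mnorm N * (1 + Mnorm (assoc (convexify N (1 / p)))) powr (1 / p) / lam) * N (\<lambda>x. norm (g x))"
proof -
  obtain K where K: "0 < K" and fubini: "\<And>(E :: ('n \<times> 'n) set) b h.
    E \<in> sets (borel \<Otimes>\<^sub>M borel) \<Longrightarrow> b \<in> borel_measurable borel \<Longrightarrow> h \<in> borel_measurable borel \<Longrightarrow>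
    (\<And>x. 0 \<le> b x) \<Longrightarrow> (\<And>x. 0 \<le> h x) \<Longrightarrow>
    (\<And>x y. (x, y) \<in> E \<Longrightarrow> x \<noteq> y \<and> (dist x y powr \<gamma> < b x \<or> dist x y powr \<gamma> < b y)) \<Longrightarrow>
    (\<integral>\<^sup>+x. riesz_fun E \<gamma> x * ennreal (h x) \<partial>lebesgue)
      \<le> ennreal K * ((\<integral>\<^sup>+x. ennreal (b x) * ennreal (h x) \<partial>lebesgue) + (\<integral>\<^sup>+x. ennreal (b x) * maximal h x \<partial>lebesgue))"
    using nn_integral_riesz_fun_le[OF \<gamma>] by blast
  define c where "c = (2::real) ^ Suc (Suc DIM('n))"
  have c: "0 < c" by (simp add: c_def)
  have p0: "0 < p" using p by simp
  show ?thesis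
  proof (rule that[of "K powr (1 / p) * c"], goal_cases)
    case 1
    show ?case using K c by simp
  next
    case (2 N f g lam)
    note N = 2(1) and YB = 2(2) and deriv = 2(5) and cont = 2(6) and lam = 2(8)
    define Y where "Y = convexify N (1 / p)"
    define A where "A = Mnorm N"
    define B where "B = Mnorm (assoc Y)"
    have Y: "ball_BFS Y" using YB by (simp add: Y_def)
    have MA: "M_bounded_by N A" unfolding A_def by (rule M_bounded_by_Mnorm[OF 2(3)])
    have MB: "M_bounded_by (assoc Y) B" unfolding B_def Y_def by (rule M_bounded_by_Mnorm[OF 2(4)])
    have A0: "0 \<le> A" and B0: "0 \<le> B" using MA MB by (auto simp: M_bounded_by_def)
    obtain Kg where Kg: "\<And>x. norm (g x) \<le> Kg" and gfin: "N (\<lambda>x. norm (g x)) < \<infinity>"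
      using continuous_bounded_support_norm_finite[OF N cont 2(7)] by blast
    obtain G where G: "N (\<lambda>x. norm (g x)) = ennreal G" "0 \<le> G"
      using gfin by (cases "N (\<lambda>x. norm (g x))") auto
    have gm[measurable]: "(\<lambda>x. norm (g x)) \<in> borel_measurable borel"
      by (intro borel_measurable_continuous_onI continuous_on_norm cont)
    have fm[measurable]: "f \<in> borel_measurable borel"
      using deriv by (intro borel_measurable_continuous_onI continuous_at_imp_continuous_on)
        (auto simp: gderiv_def intro: has_derivative_continuous)
    define m where "m x = enn2real (maximal (\<lambda>z. norm (g z)) x)" for x
    have mfin: "maximal (\<lambda>z. norm (g z)) x < \<infinity>" for x
    proof -
      have "maximal (\<lambda>z. norm (g z)) x \<le> ennreal Kg" by (rule maximal_le_const) (use Kg in simp)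
      then show ?thesis using ennreal_less_top[of Kg] le_less_trans by (metis infinity_ennreal_def)
    qed
    have mm[measurable]: "m \<in> borel_measurable borel" unfolding m_def by measurable
    define u where "u x = c / lam * m x" for x
    have um[measurable]: "u \<in> borel_measurable borel" unfolding u_def by measurable
    have u0: "0 \<le> u x" for x using c lam by (simp add: u_def m_def)
    define b where "b x = u x powr p" for x
    have bm[measurable]: "b \<in> borel_measurable borel" unfolding b_def by measurable
    have b0: "0 \<le> b x" for x by (simp add: b_def)
    \<comment> \<open>\<open>a\<close> bounds the norm in X of \<open>u\<close>, the scaled maximal
      function of the gradient; hence \<open>a powr p\<close> bounds \<open>b = u^p\<close> in
      Y.\<close>
    define a where "a = c / lam * (A * G)"
    have a0: "0 \<le> a" using c lam A0 G by (simp add: a_def)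
    have "N m \<le> ennreal A * N (\<lambda>x. norm (g x))"
      using MA gfin borel_measurable_lebesgueI[OF gm] unfolding M_bounded_by_def m_def[abs_def] by blast
    also have "\<dots> = ennreal (A * G)" using A0 G by (simp add: ennreal_mult)
    finally have "ennreal (c / lam) * N m \<le> ennreal (c / lam) * ennreal (A * G)" by (rule mult_left_mono) simp
    moreover have "N u = ennreal (c / lam) * N m"
      unfolding u_def using BFS_scale[OF N borel_measurable_lebesgueI[OF mm], of "c / lam"] c lam by simp
    ultimately have "N u \<le> ennreal a"
      using c lam A0 G by (simp add: a_def ennreal_mult[symmetric])
    then have Yb: "Y b \<le> ennreal (a powr p)"
      unfolding Y_def b_def by (intro convexify_powr_le u0 p0 a0)
    then have Ybfin: "Y b < \<infinity>" using ennreal_less_top le_less_trans by (metis infinity_ennreal_def)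
    define E where "E = Eset lam (\<gamma> / p) f"
    have Em: "E \<in> sets (borel \<Otimes>\<^sub>M borel)" unfolding E_def by (rule sets_Eset) measurable
    define F where "F = riesz_fun E \<gamma>"
    have Fm: "F \<in> borel_measurable lebesgue"
      unfolding F_def by (intro borel_measurable_lebesgueI borel_measurable_riesz_fun Em)
    \<comment> \<open>\<open>K\<close> comes from the kernel, 1 from pairing \<open>b\<close> with
      \<open>h\<close>, and \<open>B\<close> from pairing \<open>b\<close> with the maximal function
      of \<open>h\<close>.\<close>
    define C where "C = K * (1 + B) * a powr p"
    have C0: "0 \<le> C" using K B0 by (simp add: C_def)
    have dual: "(\<integral>\<^sup>+x. F x * ennreal (h x) \<partial>lebesgue) \<le> ennreal C"
      if hm: "h \<in> borel_measurable borel" and h0: "\<And>x. 0 \<le> h x" and h1: "assoc Y h \<le> 1" for h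
    proof -
      have hl: "h \<in> borel_measurable lebesgue" and bl: "b \<in> borel_measurable lebesgue"
        using hm bm by (auto intro: borel_measurable_lebesgueI)
      define Mh where "Mh x = enn2real (maximal h x)" for x
      have Mhm: "Mh \<in> borel_measurable lebesgue"
        unfolding Mh_def by (intro borel_measurable_lebesgueI) measurable
      have hf: "assoc Y h < \<infinity>" using h1 by (auto simp: le_less_trans)
      have ae: "AE x in lebesgue. maximal h x < \<infinity>" and Mle: "assoc Y Mh \<le> ennreal B * assoc Y h"
        using MB hl hf unfolding M_bounded_by_def Mh_def[abs_def] by blast+
      have I1: "(\<integral>\<^sup>+x. ennreal (b x) * ennreal (h x) \<partial>lebesgue) \<le> ennreal (a powr p)"
      proof -
        have "(\<integral>\<^sup>+x. ennreal (b x) * ennreal (h x) \<partial>lebesgue) = (\<integral>\<^sup>+x. ennreal \<bar>b x * h x\<bar> \<partial>lebesgue)"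
          using b0 h0 by (simp add: ennreal_mult)
        also have "\<dots> \<le> Y b * assoc Y h" by (rule assoc_Hoelder[OF Y bl hl Ybfin])
        also have "\<dots> \<le> ennreal (a powr p) * 1" using Yb h1 by (intro mult_mono) auto
        finally show ?thesis by simp
      qed
      \<comment> \<open>The maximal function of \<open>h\<close> is finite almost everywhere, so its
        real version \<open>Mh\<close> has the same integral and is an admissible second factor in
        the Hoelder inequality.\<close>
      have I2: "(\<integral>\<^sup>+x. ennreal (b x) * maximal h x \<partial>lebesgue) \<le> ennreal (a powr p * B)"
      proof -
        have "(\<integral>\<^sup>+x. ennreal (b x) * maximal h x \<partial>lebesgue) = (\<integral>\<^sup>+x. ennreal \<bar>b x * Mh x\<bar> \<partial>lebesgue)"
          by (rule nn_integral_cong_AE, use ae in eventually_elim)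
            (use b0 in \<open>simp add: Mh_def ennreal_mult\<close>)
        also have "\<dots> \<le> Y b * assoc Y Mh" by (rule assoc_Hoelder[OF Y bl Mhm Ybfin])
        also have "\<dots> \<le> ennreal (a powr p) * (ennreal B * 1)"
          using Yb order_trans[OF Mle mult_left_mono[OF h1]] by (intro mult_mono) auto
        finally show ?thesis using B0 by (simp add: ennreal_mult)
      qed
      have "(\<integral>\<^sup>+x. F x * ennreal (h x) \<partial>lebesgue)
        \<le> ennreal K * ((\<integral>\<^sup>+x. ennreal (b x) * ennreal (h x) \<partial>lebesgue) + (\<integral>\<^sup>+x. ennreal (b x) * maximal h x \<partial>lebesgue))"
        unfolding F_def
      proof (rule fubini[OF Em bm hm b0 h0])
        show "x \<noteq> y \<and> (dist x y powr \<gamma> < b x \<or> dist x y powr \<gamma> < b y)" if "(x, y) \<in> E" for x y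
          using Eset_subset[OF deriv cont mfin lam p0 that[unfolded E_def]]
          unfolding b_def u_def m_def c_def .
      qed
      also have "\<dots> \<le> ennreal K * (ennreal (a powr p) + ennreal (a powr p * B))"
        by (intro mult_left_mono add_mono I1 I2) auto
      also have "\<dots> = ennreal C"
        using K B0 by (simp add: C_def ennreal_mult[symmetric] ennreal_plus[symmetric] algebra_simps del: ennreal_plus)
      finally show ?thesis .
    qed
    have fin: "AE x in lebesgue. F x < \<infinity>" and le: "Y (\<lambda>x. enn2real (F x)) \<le> ennreal C"
      using BFS_le_by_duality[OF Y Fm C0 dual] by blast+
    have "N (\<lambda>x. enn2real (F x) powr (1 / p)) \<le> ennreal (C powr (1 / p))"
      by (rule le_of_convexify_le[OF _ p0 le[unfolded Y_def] C0]) simp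
    \<comment> \<open>The root undoes the power of \<open>a\<close>, so \<open>A\<close>, the
      gradient norm and \<open>1 / lam\<close> appear linearly, while \<open>K\<close> and
      \<open>1 + B\<close> keep the exponent \<open>1 / p\<close>.\<close>
    also have "C powr (1 / p) = (K powr (1 / p) * c * A * (1 + B) powr (1 / p) / lam) * G"
      using K B0 a0 p0 unfolding C_def
      by (simp add: powr_mult powr_powr) (simp add: a_def)
    also have "ennreal \<dots> = ennreal (K powr (1 / p) * c * A * (1 + B) powr (1 / p) / lam) * N (\<lambda>x. norm (g x))"
      unfolding G(1) by (rule ennreal_mult) (use K c A0 lam G in auto)
    finally show ?case
      using fin unfolding F_def E_def A_def B_def Y_def by blast
  qed
qed

theorem theorem3p1:
  fixes p q \<gamma> :: real
  assumes "\<gamma> \<noteq> 0" and "1 \<le> p" and "0 < q" and "q \<le> p"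
  shows "\<exists>Cf :: real \<Rightarrow> real \<Rightarrow> real.
     (\<forall>A>0. \<forall>B>0. Cf A B > 0) \<and>
     (\<forall>B>0. continuous_on {0<..} (\<lambda>A. Cf A B)) \<and>
     (\<forall>A>0. continuous_on {0<..} (\<lambda>B. Cf A B)) \<and>
     (\<forall>B>0. mono_on {0<..} (\<lambda>A. Cf A B)) \<and>
     (\<forall>A>0. mono_on {0<..} (\<lambda>B. Cf A B)) \<and>
     (\<forall>N :: ('n::euclidean_space \<Rightarrow> real) \<Rightarrow> ennreal.
        ball_BFS N \<and> ball_BFS (convexify N (1 / p)) \<and>
        M_bounded N \<and> M_bounded (assoc (convexify N (1 / p))) \<longrightarrow>
        (\<forall>(f :: 'n \<Rightarrow> real) (g :: 'n \<Rightarrow> 'n).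
           (\<forall>x. GDERIV f x :> g x) \<and> continuous_on UNIV g \<and> bounded {x. g x \<noteq> 0} \<longrightarrow>
           (SUP lam\<in>{0<..}. ennreal lam * Nq N q (riesz_fun (Eset lam (\<gamma> / q) f) \<gamma>))
             \<le> ennreal (Cf (Mnorm N) (Mnorm (assoc (convexify N (1 / p))))) * N (\<lambda>x. norm (g x))))"
proof -
  define s where "s = p / q"
  have s: "1 \<le> s" using assms by (simp add: s_def)
  have p0: "0 < p" using assms by simp
  \<comment> \<open>The estimate for \<open>p\<close> with \<open>\<gamma> * s\<close> in place of
    \<open>\<gamma>\<close> thus concerns the same level set; only the weight in the integral
    differs.\<close>
  have gs: "\<gamma> * s / p = \<gamma> / q" using p0 by (simp add: s_def)
  have gs0: "\<gamma> * s \<noteq> 0" using assms s by simp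
  obtain L where L: "0 < L" and est: "\<And>(N :: ('n \<Rightarrow> real) \<Rightarrow> ennreal) f g lam.
    ball_BFS N \<Longrightarrow> ball_BFS (convexify N (1 / p)) \<Longrightarrow>
    M_bounded N \<Longrightarrow> M_bounded (assoc (convexify N (1 / p))) \<Longrightarrow>
    (\<And>x. GDERIV f x :> g x) \<Longrightarrow> continuous_on UNIV g \<Longrightarrow> bounded {x. g x \<noteq> 0} \<Longrightarrow> 0 < lam \<Longrightarrow>
    (AE x in lebesgue. riesz_fun (Eset lam (\<gamma> * s / p) f) (\<gamma> * s) x < \<infinity>) \<and>
    N (\<lambda>x. enn2real (riesz_fun (Eset lam (\<gamma> * s / p) f) (\<gamma> * s) x) powr (1 / p))
      \<le> ennreal (L * Mnorm N * (1 + Mnorm (assoc (convexify N (1 / p)))) powr (1 / p) / lam) * N (\<lambda>x. norm (g x))"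
    using weak_gradient_estimate[OF gs0 assms(2)] by blast
  obtain K where K: "0 < K" and chg: "\<And>(E :: ('n \<times> 'n) set) x.
    E \<in> sets (borel \<Otimes>\<^sub>M borel) \<Longrightarrow> (\<And>x. (x, x) \<notin> E) \<Longrightarrow> riesz_fun E (\<gamma> * s) x < \<infinity> \<Longrightarrow>
    riesz_fun E \<gamma> x \<le> ennreal (K * enn2real (riesz_fun E (\<gamma> * s) x) powr (1 / s))"
    using riesz_fun_change_exponent[OF assms(1) s] by blast
  \<comment> \<open>\<open>L\<close> belongs to the estimate with exponent \<open>p\<close> and
    \<open>K\<close> to the change of exponent, taken to the power \<open>1 / q\<close>. In
    \<open>B\<close> the factor is a positive power of \<open>1 + B\<close>, in \<open>A\<close> it
    is linear.\<close>
  define Cf where "Cf A B = K powr (1 / q) * L * A * (1 + B) powr (1 / p)" for A B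
  have main: "ennreal lam * Nq N q (riesz_fun (Eset lam (\<gamma> / q) f) \<gamma>)
      \<le> ennreal (Cf (Mnorm N) (Mnorm (assoc (convexify N (1 / p))))) * N (\<lambda>x. norm (g x))"
    if N: "ball_BFS N" and Y: "ball_BFS (convexify N (1 / p))"
      and MN: "M_bounded N" and MY: "M_bounded (assoc (convexify N (1 / p)))"
      and deriv: "\<And>x. GDERIV f x :> g x" and cont: "continuous_on UNIV g" and supp: "bounded {x. g x \<noteq> 0}"
      and lam: "0 < lam"
    for N :: "('n \<Rightarrow> real) \<Rightarrow> ennreal" and f g lam
  proof -
    define A where "A = Mnorm N"
    define B where "B = Mnorm (assoc (convexify N (1 / p)))"
    have A0: "0 \<le> A" using M_bounded_by_Mnorm[OF MN] by (simp add: A_def M_bounded_by_def)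
    define E where "E = Eset lam (\<gamma> / q) f"
    define F where "F = riesz_fun E \<gamma>"
    define F' where "F' = riesz_fun E (\<gamma> * s)"
    have fm: "f \<in> borel_measurable borel"
      using deriv by (intro borel_measurable_continuous_onI continuous_at_imp_continuous_on)
        (auto simp: gderiv_def intro: has_derivative_continuous)
    have Em: "E \<in> sets (borel \<Otimes>\<^sub>M borel)" unfolding E_def by (rule sets_Eset[OF fm])
    have Fm[measurable]: "F \<in> borel_measurable borel" "F' \<in> borel_measurable borel"
      unfolding F_def F'_def by (intro borel_measurable_riesz_fun Em)+
    have diag: "(x, x) \<notin> E" for x by (simp add: E_def Eset_def)
    have fin: "AE x in lebesgue. F' x < \<infinity>"
      and le: "N (\<lambda>x. enn2real (F' x) powr (1 / p)) \<le> ennreal (L * A * (1 + B) powr (1 / p) / lam) * N (\<lambda>x. norm (g x))"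
      using est[OF N Y MN MY deriv cont supp lam] unfolding gs F'_def E_def A_def B_def by blast+
    define X where "X = L * A * (1 + B) powr (1 / p) / lam"
    have X0: "0 \<le> X" using L A0 lam by (simp add: X_def)
    \<comment> \<open>Since \<open>s * q = p\<close>, raising the changed-exponent bound to the
      power \<open>1 / q\<close> yields exactly the function \<open>F' powr (1 / p)\<close> whose
      norm is already controlled.\<close>
    have pt: "AE x in lebesgue. F x < \<infinity> \<and> enn2real (F x) powr (1 / q) \<le> K powr (1 / q) * enn2real (F' x) powr (1 / p)"
      using fin
    proof eventually_elim
      case (elim x)
      have le: "F x \<le> ennreal (K * enn2real (F' x) powr (1 / s))"
        unfolding F_def F'_def by (rule chg[OF Em diag]) (use elim in \<open>simp add: F'_def\<close>)
      then have "F x < \<infinity>" using ennreal_less_top le_less_trans by (metis infinity_ennreal_def)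
      moreover have "enn2real (F x) \<le> K * enn2real (F' x) powr (1 / s)"
        using le K by (intro enn2real_leI) auto
      then have "enn2real (F x) powr (1 / q) \<le> (K * enn2real (F' x) powr (1 / s)) powr (1 / q)"
        using assms by (intro powr_mono2) auto
      then have "enn2real (F x) powr (1 / q) \<le> K powr (1 / q) * enn2real (F' x) powr (1 / p)"
        using K assms by (simp add: powr_mult powr_powr s_def)
      ultimately show ?case by blast
    qed
    have m1: "(\<lambda>x. enn2real (F x) powr (1 / q)) \<in> borel_measurable lebesgue"
      and m2: "(\<lambda>x. enn2real (F' x) powr (1 / p)) \<in> borel_measurable lebesgue"
      by (intro borel_measurable_lebesgueI; measurable)+
    have "AE x in lebesgue. F x < \<infinity>" using pt by eventually_elim simp
    then have "Nq N q F = N (\<lambda>x. enn2real (F x) powr (1 / q))" by (simp add: Nq_def)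
    also have "\<dots> \<le> N (\<lambda>x. K powr (1 / q) * enn2real (F' x) powr (1 / p))"
      by (rule BFS_mono[OF N _ m1]) (use m2 pt in auto)
    also have "\<dots> = ennreal (K powr (1 / q)) * N (\<lambda>x. enn2real (F' x) powr (1 / p))"
      using BFS_scale[OF N m2, of "K powr (1 / q)"] by simp
    also have "\<dots> \<le> ennreal (K powr (1 / q)) * (ennreal X * N (\<lambda>x. norm (g x)))"
      unfolding X_def by (intro mult_left_mono le) simp
    finally have "ennreal lam * Nq N q F \<le> ennreal lam * (ennreal (K powr (1 / q)) * (ennreal X * N (\<lambda>x. norm (g x))))"
      by (rule mult_left_mono) simp
    also have "\<dots> = ennreal (lam * (K powr (1 / q) * X)) * N (\<lambda>x. norm (g x))"
      using lam X0 by (simp add: ennreal_mult mult.assoc)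
    also have "lam * (K powr (1 / q) * X) = Cf A B"
      using lam by (simp add: Cf_def X_def)
    finally show ?thesis by (simp add: F_def E_def A_def B_def)
  qed
  show ?thesis
  proof (intro exI[of _ Cf] conjI allI impI)
    show "0 < Cf A B" if "0 < A" "0 < B" for A B using that K L by (simp add: Cf_def)
    show "continuous_on {0<..} (\<lambda>A. Cf A B)" for B unfolding Cf_def by (intro continuous_intros)
    show "continuous_on {0<..} (Cf A)" for A unfolding Cf_def by (intro continuous_intros) auto
    show "mono_on {0<..} (\<lambda>A. Cf A B)" for B
      unfolding Cf_def using L by (intro mono_onI mult_right_mono mult_left_mono) auto
    show "mono_on {0<..} (Cf A)" if "0 < A" for A
      unfolding Cf_def using L that p0 by (intro mono_onI mult_left_mono powr_mono2) auto
  next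
    fix N :: "('n \<Rightarrow> real) \<Rightarrow> ennreal" and f :: "'n \<Rightarrow> real" and g :: "'n \<Rightarrow> 'n"
    assume "ball_BFS N \<and> ball_BFS (convexify N (1 / p)) \<and> M_bounded N \<and> M_bounded (assoc (convexify N (1 / p)))"
      and "(\<forall>x. GDERIV f x :> g x) \<and> continuous_on UNIV g \<and> bounded {x. g x \<noteq> 0}"
    then show "(SUP lam\<in>{0<..}. ennreal lam * Nq N q (riesz_fun (Eset lam (\<gamma> / q) f) \<gamma>))
      \<le> ennreal (Cf (Mnorm N) (Mnorm (assoc (convexify N (1 / p))))) * N (\<lambda>x. norm (g x))"
      by (intro SUP_least main) auto
  qed
qed

end
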